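(* Fix $L\in\mathbb{N}$, $\eta\in[0,1/L)$ and $\delta>0$. Then there exists a deterministic subsequence $(t_k^{\delta,\eta})_{k\in\mathbb{N}}$ of $\mathbb{N}_{L,\eta}$ with $$\limsup_{k\to\infty}\frac{t_k^{\delta,\eta}}{k}\le \frac{1+\delta}{L}$$ such that $\big(M_{t_k^{\delta,\eta}}-E^\xi[M_{t_k^{\delta,\eta}}]\big)_{k\in\mathbb{N}}$ is tight with respect to the annealed measure.
   Context: Branching random walk in random environment (BRWRE). Let $(\xi(x))_{x\in\mathbb{Z}}$ be an i.i.d. collection of random variables on a probability space $(\Omega,\mathcal{F},\mathbb{P})$ with $0<\mathrm{ei}:=\operatorname{ess\,inf}\xi(0)<\operatorname{ess\,sup}\xi(0)=:\mathrm{es}<\infty$. Given a realization of $\xi$, start with one particle at site $0$. All particles move independently according to a continuous-time simple (symmetric nearest-neighbour) random walk on $\mathbb{Z}$ with jump rate $1$. While at site $x$, a particle splits into two at rate $\xi(x)$, independently of everything else; the resulting particles then evolve independently according to the same mechanism. $P^\xi$, $E^\xi$ (quenched law and expectation) denote the law of this process given $\xi$ and the corresponding expectation. The annealed measure is $P=\mathbb{P}\otimes P^\xi$, the joint law of the environment and the process. $N(t)$ is the set of particles alive at time $t$; for $Y\in N(t)$, $(Y_s)_{s\in[0,t]}$ is the trajectory of the particle and its ancestors up to time $t$. $M_t:=\max_{Y\in N(t)}Y_t$. $\mathbb{N}=\{1,2,\dots\}$ and $\mathbb{N}_{L,\eta}:=\mathbb{N}/L+\eta=\{k/L+\eta:k\in\mathbb{N}\}$.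 A subsequence of $\mathbb{N}_{L,\eta}$ is a strictly increasing sequence of elements of $\mathbb{N}_{L,\eta}$. *)

theory Defs
  imports "HOL-Probability.Probability"
begin

definition essinf :: "'a measure \<Rightarrow> ('a \<Rightarrow> ereal) \<Rightarrow> ereal" where
  "essinf M f = Sup {z. AE x in M. z \<le> f x}"

text \<open>
  The quenched process is built from competing exponential clocks. The life of the population is cut
  into sojourns, a sojourn being a maximal time interval during which one particle neither jumps nor
  splits; by memorylessness of the exponential distribution, all clocks may be renewed at the
  start of a sojourn. Sojourns are labelled by finite words over \<^typ>\<open>bool\<close>, the most recent
  letter first, so that \<open>b # u\<close> is a successor of \<open>u\<close>. Each label \<open>u\<close> carries a triple
  \<open>(j, s, d)\<close>, and these triples are independent: \<open>j\<close> is the waiting time of the jump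
  clock, exponential with rate 1; \<open>s\<close> is exponential with rate 1 too, so that \<open>s / \<xi> x\<close> is the waiting
  time of a splitting clock with rate \<open>\<xi> x\<close>; \<open>d\<close> is the direction of the jump, uniform on
  \<open>{-1, 1}\<close>.
\<close>

type_synonym clocks = "bool list \<Rightarrow> real \<times> real \<times> int"

definition unit_exponential :: "real measure" where
  "unit_exponential = density lborel (\<lambda>x. ennreal (exponential_density 1 x))"

definition clock_space :: "clocks measure" where
  "clock_space = (\<Pi>\<^sub>M u\<in>UNIV.
     unit_exponential \<Otimes>\<^sub>M (unit_exponential \<Otimes>\<^sub>M measure_pmf (pmf_of_set {-1, 1})))"

definition jump_clock :: "clocks \<Rightarrow> bool list \<Rightarrow> real" where
  "jump_clock c u = fst (c u)"

definition split_clock :: "real \<Rightarrow> clocks \<Rightarrow> bool list \<Rightarrow> real" where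
  "split_clock r c u = fst (snd (c u)) / r"

definition direction :: "clocks \<Rightarrow> bool list \<Rightarrow> int" where
  "direction c u = snd (snd (c u))"

primrec site :: "(int \<Rightarrow> real) \<Rightarrow> clocks \<Rightarrow> bool list \<Rightarrow> int" where
  "site \<xi> c [] = 0"
| "site \<xi> c (b # u) =
     (if jump_clock c u < split_clock (\<xi> (site \<xi> c u)) c u
      then site \<xi> c u + direction c u else site \<xi> c u)"

definition jumps :: "(int \<Rightarrow> real) \<Rightarrow> clocks \<Rightarrow> bool list \<Rightarrow> bool" where
  "jumps \<xi> c u \<longleftrightarrow> jump_clock c u < split_clock (\<xi> (site \<xi> c u)) c u"

definition sojourn_time :: "(int \<Rightarrow> real) \<Rightarrow> clocks \<Rightarrow> bool list \<Rightarrow> real" where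
  "sojourn_time \<xi> c u = min (jump_clock c u) (split_clock (\<xi> (site \<xi> c u)) c u)"

primrec start_time :: "(int \<Rightarrow> real) \<Rightarrow> clocks \<Rightarrow> bool list \<Rightarrow> real" where
  "start_time \<xi> c [] = 0"
| "start_time \<xi> c (b # u) = start_time \<xi> c u + sojourn_time \<xi> c u"

text \<open>A sojourn that ends with a jump has one successor; one that ends with a split has two.\<close>

primrec occurs :: "(int \<Rightarrow> real) \<Rightarrow> clocks \<Rightarrow> bool list \<Rightarrow> bool" where
  "occurs \<xi> c [] \<longleftrightarrow> True"
| "occurs \<xi> c (b # u) \<longleftrightarrow> occurs \<xi> c u \<and> (jumps \<xi> c u \<longrightarrow> b = False)"

text \<open>A particle alive at time \<open>t\<close> is identified with the sojourn it is in at time \<open>t\<close>.\<close>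

definition particles :: "(int \<Rightarrow> real) \<Rightarrow> clocks \<Rightarrow> real \<Rightarrow> bool list set" where
  "particles \<xi> c t = {u. occurs \<xi> c u \<and>
     start_time \<xi> c u \<le> t \<and> t < start_time \<xi> c u + sojourn_time \<xi> c u}"

definition max_particle :: "(int \<Rightarrow> real) \<Rightarrow> clocks \<Rightarrow> real \<Rightarrow> real" where
  "max_particle \<xi> c t = real_of_int (Max (site \<xi> c ` particles \<xi> c t))"

definition quenched_mean_max :: "(int \<Rightarrow> real) \<Rightarrow> real \<Rightarrow> real" where
  "quenched_mean_max \<xi> t = (\<integral>c. max_particle \<xi> c t \<partial>clock_space)"

text \<open>
  Given the environment, the quenched law is the law under \<^const>\<open>clock_space\<close> of the process
  defined above. Hence the joint law of environment and process is the image of the product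
  measure below.
\<close>

definition annealed :: "'w measure \<Rightarrow> ('w \<times> clocks) measure" where
  "annealed Q = Q \<Otimes>\<^sub>M clock_space"

definition centred_max :: "(int \<Rightarrow> 'w \<Rightarrow> real) \<Rightarrow> real \<Rightarrow> 'w \<times> clocks \<Rightarrow> real" where
  "centred_max \<xi> t = (\<lambda>(w, c).
     max_particle (\<lambda>x. \<xi> x w) c t - quenched_mean_max (\<lambda>x. \<xi> x w) t)"

definition shifted_lattice :: "nat \<Rightarrow> real \<Rightarrow> real set" where
  "shifted_lattice L \<eta> = {real k / real L + \<eta> | k. k \<ge> 1}"

end

theory Submission
  imports Defs
begin

text \<open>
  The proof is a Dekking--Host argument. Let \<open>M\<close> and \<open>M'\<close> be the rightmost positions at time \<open>t\<close> of
  two populations that start at \<open>0\<close> and evolve independently in the same environment \<open>\<xi>\<close>, and call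
  \<open>gap \<xi> t = E (M' - M)\<^sup>+\<close> the gap. Since \<open>max M M' = M + (M' - M)\<^sup>+\<close>, a particle that splits gains
  exactly the gap, on average, over one that does not.

  Decomposing the population at the end of the first sojourn gives an integral equation for the
  law of the maximum (\<open>renewal_equation\<close>). In its time-integrated form, the jumps of the first
  particle contribute the increment between the mean maximum started from a neighbour of \<open>0\<close> and
  the one started from \<open>0\<close>. Averaged over a stationary environment this cancels, and what is left is
  \<open>E M = \<integral>\<^sub>0\<^sup>t E [\<xi> 0 * gap \<xi> s] ds\<close>. A first-moment bound on \<open>exp M\<close> shows that \<open>E M\<close> grows at most
  linearly, and so does the integral of the gap (\<open>integrated_gap_le\<close>).

  The gap cannot fall quickly. With probability \<open>exp (- (1 + \<xi> 0) * h)\<close> the first particle neither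
  jumps nor splits up to time \<open>h\<close>, and then the population is merely delayed by \<open>h\<close>; asking this of
  two independent populations gives \<open>gap_persists\<close>. Hence the integral bound is also a bound on sums
  over any lattice of times (\<open>lattice_sum_mean_gap_le\<close>): the partial sums of the annealed mean gap
  grow at most linearly. So all but a small proportion of the lattice times have an annealed mean
  gap below a large constant, and enumerating them gives a sequence of the required density
  (\<open>frequently_small_terms\<close>).

  Along these times the deviation from the quenched mean is bounded in \<open>L\<^sup>1\<close>, because
  \<open>E |M - E M| \<le> E |M - M'| = 2 * gap \<xi> t\<close>, and Markov's inequality gives tightness.

  Almost all integrals are taken in \<^typ>\<open>ennreal\<close>, so that Tonelli's theorem needs no integrability.
  The positive and the negative part of the maximum are therefore followed separately; they are
  subtracted only once, in \<open>integrated_gap_le\<close>.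
\<close>

section \<open>The first sojourn and the two subtrees\<close>

abbreviation env_space :: "(int \<Rightarrow> real) measure" where
  "env_space \<equiv> \<Pi>\<^sub>M x\<in>UNIV. borel"

definition clock_law :: "(real \<times> real \<times> int) measure" where
  "clock_law = unit_exponential \<Otimes>\<^sub>M (unit_exponential \<Otimes>\<^sub>M measure_pmf (pmf_of_set {-1, 1}))"

lemma ennreal_double_half [simp]: "(x + x) / 2 = (x :: ennreal)"
  using ennreal_mult_divide_eq[of 2 x] by (simp add: mult_2_right)

lemma sets_unit_exponential [measurable_cong]: "sets unit_exponential = sets borel"
  by (simp add: unit_exponential_def)

lemma space_unit_exponential [simp]: "space unit_exponential = UNIV"
  by (simp add: unit_exponential_def)

lemma prob_space_unit_exponential: "prob_space unit_exponential"
  unfolding unit_exponential_def by (rule prob_space_exponential_density) simp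

lemma sets_clock_law [measurable_cong]:
  "sets clock_law = sets (borel \<Otimes>\<^sub>M (borel \<Otimes>\<^sub>M count_space UNIV))"
  unfolding clock_law_def by (intro sets_pair_measure_cong sets_unit_exponential) simp

lemma space_clock_law [simp]: "space clock_law = UNIV"
  by (simp add: clock_law_def space_pair_measure)

lemma prob_space_clock_law: "prob_space clock_law"
  unfolding clock_law_def
  by (intro prob_space_pair prob_space_unit_exponential prob_space_measure_pmf)

lemma clock_space_eq: "clock_space = (\<Pi>\<^sub>M u\<in>UNIV. clock_law)"
  by (simp add: clock_space_def clock_law_def)

lemma sets_clock_space [measurable_cong]:
  "sets clock_space = sets (\<Pi>\<^sub>M u\<in>UNIV. (borel \<Otimes>\<^sub>M (borel \<Otimes>\<^sub>M count_space UNIV)))"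
  unfolding clock_space_eq by (intro sets_PiM_cong refl sets_clock_law)

lemma space_clock_space [simp]: "space clock_space = UNIV"
  by (simp add: clock_space_eq space_PiM)

interpretation clocks: product_prob_space "\<lambda>_ :: bool list. clock_law" UNIV
  by (intro product_prob_spaceI prob_space_clock_law)

interpretation clock_space: prob_space clock_space
  unfolding clock_space_eq by (rule clocks.prob_space_axioms)

lemma emeasure_clock_space_UNIV [simp]: "emeasure clock_space UNIV = 1"
  using clock_space.emeasure_space_1 by simp

text \<open>
  The clocks of the whole population, rebuilt from the triple of the root and from the clocks of its
  two subtrees. Words have their most recent letter first, so the root decision is the last letter.
\<close>

definition graft :: "real \<times> real \<times> int \<Rightarrow> clocks \<Rightarrow> clocks \<Rightarrow> clocks" where
  "graft x c c' u = (if u = [] then x else (if last u then c' else c) (butlast u))"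

lemma graft_Nil [simp]: "graft x c c' [] = x"
  and graft_False [simp]: "graft x c c' (v @ [False]) = c v"
  and graft_True [simp]: "graft x c c' (v @ [True]) = c' v"
  by (simp_all add: graft_def)

lemma measurable_graft [measurable]:
  "(\<lambda>(x, c, c'). graft x c c') \<in> clock_law \<Otimes>\<^sub>M (clock_space \<Otimes>\<^sub>M clock_space) \<rightarrow>\<^sub>M clock_space"
  unfolding clock_space_eq
proof (rule measurable_PiM_single')
  fix u :: "bool list"
  show "(\<lambda>p. (case p of (x, c, c') \<Rightarrow> graft x c c') u)
     \<in> clock_law \<Otimes>\<^sub>M (Pi\<^sub>M UNIV (\<lambda>u. clock_law) \<Otimes>\<^sub>M Pi\<^sub>M UNIV (\<lambda>u. clock_law)) \<rightarrow>\<^sub>M clock_law"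
    by (cases u rule: rev_cases; cases "u \<noteq> [] \<and> last u")
       (auto simp: graft_def split_beta' intro: measurable_compose[OF _ measurable_component_singleton])
qed (simp add: space_PiM)

text \<open>
  The independence of different labels is used only in this form: the root triple and the
  two subtrees are independent, and each subtree is distributed like the whole tree. It suffices to
  compare finite-dimensional cylinders, and a cylinder splits according to the last letter of its
  coordinates.
\<close>

lemma distr_graft:
  "distr (clock_law \<Otimes>\<^sub>M (clock_space \<Otimes>\<^sub>M clock_space)) clock_space (\<lambda>(x, c, c'). graft x c c')
    = clock_space" (is "distr ?P _ ?g = _")
proof -
  have "distr ?P clock_space ?g = PiM UNIV (\<lambda>_. clock_law)"
  proof (rule clocks.PiM_eq)
    show "sets (distr ?P clock_space ?g) = sets (PiM UNIV (\<lambda>_. clock_law))"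
      by (simp add: clock_space_eq)
    fix J :: "bool list set" and F :: "bool list \<Rightarrow> (real \<times> real \<times> int) set"
    assume J: "finite J" and F: "\<And>j. j \<in> J \<Longrightarrow> F j \<in> sets clock_law"
    define A where "A = (if [] \<in> J then F [] else UNIV)"
    define I where "I b = {v. v @ [b] \<in> J}" for b
    define B where "B b = prod_emb UNIV (\<lambda>_. clock_law) (I b) (\<Pi>\<^sub>E v\<in>I b. F (v @ [b]))" for b
    have I: "finite (I b)" for b
      using finite_vimageI[OF J, of "\<lambda>v. v @ [b]"] by (simp add: I_def vimage_def inj_def)
    have A: "A \<in> sets clock_law"
      using F sets.top[of clock_law] by (auto simp: A_def)
    have B: "B b \<in> sets clock_space" for b
      unfolding B_def clock_space_eq using I F
      by (intro sets_PiM_I) (auto simp: I_def)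
    have J_eq: "J = (J \<inter> {[]}) \<union> ((\<lambda>v. v @ [False]) ` I False \<union> (\<lambda>v. v @ [True]) ` I True)"
    proof -
      have "u \<in> (\<lambda>v. v @ [False]) ` I False \<union> (\<lambda>v. v @ [True]) ` I True"
        if "u \<in> J" "u \<noteq> []" for u
      proof (cases u rule: rev_cases)
        case (snoc v b) then show ?thesis using that by (cases b) (auto simp: I_def)
      qed (use that in auto)
      then show ?thesis by (auto simp: I_def)
    qed
    have emb: "prod_emb UNIV (\<lambda>_. clock_law) J (\<Pi>\<^sub>E j\<in>J. F j) = {c. \<forall>u\<in>J. c u \<in> F u}"
      by (auto simp: prod_emb_def PiE_def Pi_iff)
    have Bmem: "B b = {c. \<forall>v\<in>I b. c v \<in> F (v @ [b])}" for b
      by (auto simp: B_def prod_emb_def PiE_def Pi_iff)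
    have "?g -` prod_emb UNIV (\<lambda>_. clock_law) J (\<Pi>\<^sub>E j\<in>J. F j) \<inter> space ?P
        = A \<times> (B False \<times> B True)"
      unfolding emb Bmem
      by (subst J_eq) (auto simp: A_def space_pair_measure ball_Un)
    moreover have "prod_emb UNIV (\<lambda>_. clock_law) J (\<Pi>\<^sub>E j\<in>J. F j) \<in> sets clock_space"
      unfolding clock_space_eq using J F by (intro sets_PiM_I) auto
    ultimately have "emeasure (distr ?P clock_space ?g)
         (prod_emb UNIV (\<lambda>_. clock_law) J (\<Pi>\<^sub>E j\<in>J. F j)) = emeasure ?P (A \<times> (B False \<times> B True))"
      by (simp add: emeasure_distr)
    also have "\<dots> = emeasure clock_law A *
        (emeasure clock_space (B False) * emeasure clock_space (B True))"
    proof -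
      interpret pair_sigma_finite clock_space clock_space ..
      show ?thesis
        using A B by (subst emeasure_pair_measure_Times clock_space.emeasure_pair_measure_Times; simp)+
    qed
    also have "\<dots> = (\<Prod>u\<in>J \<inter> {[]}. emeasure clock_law (F u)) *
        ((\<Prod>v\<in>I False. emeasure clock_law (F (v @ [False]))) *
         (\<Prod>v\<in>I True. emeasure clock_law (F (v @ [True]))))"
    proof -
      have "emeasure clock_space (B b) = (\<Prod>v\<in>I b. emeasure clock_law (F (v @ [b])))" for b
        unfolding B_def clock_space_eq using I F
        by (intro clocks.emeasure_PiM_emb) (auto simp: I_def)
      moreover have "emeasure clock_law A = (\<Prod>u\<in>J \<inter> {[]}. emeasure clock_law (F u))"
        using clocks.M.emeasure_space_1 by (auto simp: A_def)
      ultimately show ?thesis by simp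
    qed
    also have "\<dots> = (\<Prod>j\<in>J. emeasure clock_law (F j))"
    proof -
      let ?S = "\<lambda>b. (\<lambda>v. v @ [b]) ` I b" and ?h = "\<lambda>j. emeasure clock_law (F j)"
      have "prod ?h (?S b) = (\<Prod>v\<in>I b. ?h (v @ [b]))" for b
        by (subst prod.reindex) (auto simp: inj_on_def)
      moreover have "prod ?h (?S False \<union> ?S True) = prod ?h (?S False) * prod ?h (?S True)"
        using I by (intro prod.union_disjoint) auto
      moreover have "prod ?h ((J \<inter> {[]}) \<union> (?S False \<union> ?S True)) =
          prod ?h (J \<inter> {[]}) * prod ?h (?S False \<union> ?S True)"
        using I J by (intro prod.union_disjoint) auto
      ultimately show ?thesis
        using J_eq by metis
    qed
    finally show "emeasure (distr ?P clock_space ?g)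
         (prod_emb UNIV (\<lambda>_. clock_law) J (\<Pi>\<^sub>E j\<in>J. F j)) = (\<Prod>j\<in>J. emeasure clock_law (F j))" .
  qed
  then show ?thesis by (simp add: clock_space_eq)
qed

lemma nn_integral_clock_space:
  assumes [measurable]: "\<Phi> \<in> borel_measurable clock_space"
  shows "(\<integral>\<^sup>+c. \<Phi> c \<partial>clock_space) =
    (\<integral>\<^sup>+x. (\<integral>\<^sup>+c. (\<integral>\<^sup>+c'. \<Phi> (graft x c c') \<partial>clock_space) \<partial>clock_space) \<partial>clock_law)"
proof -
  interpret CC: prob_space "clock_space \<Otimes>\<^sub>M clock_space"
    by (intro prob_space_pair clock_space.prob_space_axioms)
  have "(\<integral>\<^sup>+c. \<Phi> c \<partial>clock_space) =
     (\<integral>\<^sup>+p. \<Phi> (case p of (x, c, c') \<Rightarrow> graft x c c') \<partial>(clock_law \<Otimes>\<^sub>M (clock_space \<Otimes>\<^sub>M clock_space)))"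
    by (subst distr_graft[symmetric], subst nn_integral_distr) simp_all
  also have "\<dots> = (\<integral>\<^sup>+x. (\<integral>\<^sup>+c. (\<integral>\<^sup>+c'. \<Phi> (graft x c c') \<partial>clock_space) \<partial>clock_space) \<partial>clock_law)"
    by (subst CC.nn_integral_fst[symmetric], simp)
       (subst clock_space.nn_integral_fst[symmetric], simp_all)
  finally show ?thesis .
qed

section \<open>Two competing exponential clocks\<close>

lemma AE_unit_exponential: "AE s in unit_exponential. 0 < s"
  unfolding unit_exponential_def
  by (subst AE_density) (auto simp: exponential_density_def intro!: AE_I[where N="{0}"])

lemma nn_integral_unit_exponential:
  assumes [measurable]: "f \<in> borel_measurable borel"
  shows "(\<integral>\<^sup>+s. f s \<partial>unit_exponential) =
    (\<integral>\<^sup>+s. ennreal (exp (- s)) * f s * indicator {0<..} s \<partial>lborel)"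
proof -
  have "AE s in lborel. s \<noteq> (0::real)"
    by (rule AE_lborel_singleton)
  then have "AE s in lborel. ennreal (exponential_density 1 s) * f s
      = ennreal (exp (- s)) * f s * indicator {0<..} s"
    by eventually_elim (auto simp: exponential_density_def indicator_def)
  then show ?thesis
    unfolding unit_exponential_def
    by (subst nn_integral_density) (auto intro: nn_integral_cong_AE)
qed

lemma nn_integral_exponential_atLeast:
  fixes l t :: real
  assumes "0 < l"
  shows "(\<integral>\<^sup>+s. ennreal (l * exp (- l * s)) * indicator {t..} s \<partial>lborel) = ennreal (exp (- l * t))"
proof -
  have "((\<lambda>s::real. - exp (- l * s)) \<longlongrightarrow> - 0) at_top"
    using assms by real_asymp
  then have "(\<integral>\<^sup>+s. ennreal (l * exp (- l * s)) * indicator {t..} s \<partial>lborel) = ennreal (0 - (- exp (- l * t)))"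
    using assms by (intro nn_integral_FTC_atLeast) (auto intro!: derivative_eq_intros)
  then show ?thesis by simp
qed

lemma nn_integral_exponential_greaterThan:
  fixes l t :: real
  assumes "0 < l"
  shows "(\<integral>\<^sup>+s. ennreal (l * exp (- l * s)) * indicator {t<..} s \<partial>lborel) = ennreal (exp (- l * t))"
proof -
  have "AE s in lborel. s \<noteq> t"
    by (rule AE_lborel_singleton)
  then have "(\<integral>\<^sup>+s. ennreal (l * exp (- l * s)) * indicator {t<..} s \<partial>lborel) =
      (\<integral>\<^sup>+s. ennreal (l * exp (- l * s)) * indicator {t..} s \<partial>lborel)"
    by (intro nn_integral_cong_AE) (auto simp: indicator_def elim!: eventually_mono)
  then show ?thesis using nn_integral_exponential_atLeast[OF assms] by simp
qed

lemma emeasure_unit_exponential_greaterThan: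
  assumes "0 \<le> x"
  shows "emeasure unit_exponential {x<..} = ennreal (exp (- x))"
proof -
  have "emeasure unit_exponential {x<..} = (\<integral>\<^sup>+s. indicator {x<..} s \<partial>unit_exponential)"
    by (subst nn_integral_indicator) (simp_all add: sets_unit_exponential)
  also have "\<dots> = (\<integral>\<^sup>+s. ennreal (exp (- s)) * indicator {x<..} s * indicator {0<..} s \<partial>lborel)"
    by (rule nn_integral_unit_exponential) simp
  also have "\<dots> = (\<integral>\<^sup>+s. ennreal (1 * exp (- 1 * s)) * indicator {x<..} s \<partial>lborel)"
    using assms by (intro nn_integral_cong) (auto simp: indicator_def)
  finally show ?thesis
    by (simp only: nn_integral_exponential_greaterThan) simp
qed

lemma emeasure_unit_exponential_atLeast:
  assumes "0 \<le> x"
  shows "emeasure unit_exponential {x..} = ennreal (exp (- x))"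
proof -
  have "AE s in lborel. s \<noteq> x"
    by (rule AE_lborel_singleton)
  then have "AE s in unit_exponential. s \<noteq> x"
    unfolding unit_exponential_def by (subst AE_density) auto
  then have "emeasure unit_exponential {x..} = emeasure unit_exponential {x<..}"
    by (intro emeasure_eq_AE) (auto simp: sets_unit_exponential elim!: eventually_mono)
  with emeasure_unit_exponential_greaterThan[OF assms] show ?thesis by simp
qed

text \<open>
  The minimum of the two clocks is exponential with rate \<open>1 + r\<close>, and independently of it the jump
  clock wins with probability \<open>1 / (1 + r)\<close>. The total rate cancels against the density, which is
  why the jump enters with weight \<open>1\<close> and the split with weight \<open>r\<close>.
\<close>

lemma exponential_race:
  fixes gJ :: "int \<Rightarrow> real \<Rightarrow> ennreal" and gS :: "real \<Rightarrow> ennreal"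
  assumes r: "0 < r"
    and gJ [measurable]: "\<And>d. gJ d \<in> borel_measurable borel"
    and gS [measurable]: "gS \<in> borel_measurable borel"
  shows "(\<integral>\<^sup>+(j, s, d). (if j < s / r then gJ d j else gS (s / r)) \<partial>clock_law) =
    (\<integral>\<^sup>+s. ennreal (exp (- (1 + r) * s)) *
       ((gJ 1 s + gJ (-1) s) / 2 + ennreal r * gS s) * indicator {0<..} s \<partial>lborel)"
proof -
  let ?E = unit_exponential and ?D = "measure_pmf (pmf_of_set {-1, 1 :: int})"
  interpret E: prob_space ?E by (rule prob_space_unit_exponential)
  interpret EE: pair_prob_space ?E ?E ..
  interpret ED: prob_space "?E \<Otimes>\<^sub>M ?D"
    by (intro prob_space_pair prob_space_unit_exponential prob_space_measure_pmf)
  define G where "G s = (gJ 1 s + gJ (-1) s) / 2" for s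
  have G [measurable]: "G \<in> borel_measurable borel"
    unfolding G_def by measurable
  define H where "H = (\<lambda>(j, s, d). if j < s / r then gJ d j else gS (s / r))"
  have H: "H \<in> borel_measurable (?E \<Otimes>\<^sub>M (?E \<Otimes>\<^sub>M ?D))"
    unfolding H_def split_beta'
    by (rule measurable_compose_countable[where g="\<lambda>p. snd (snd p)" and
          f="\<lambda>d p. if fst p < fst (snd p) / r then gJ d (fst p) else gS (fst (snd p) / r)"]) measurable
  have H' [measurable]: "(\<lambda>q. H (j, q)) \<in> borel_measurable (?E \<Otimes>\<^sub>M ?D)" for j
    using measurable_compose[OF measurable_Pair1' H, of j] by (simp add: comp_def)
  have "(\<integral>\<^sup>+(j, s, d). (if j < s / r then gJ d j else gS (s / r)) \<partial>clock_law) =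
    (\<integral>\<^sup>+j. (\<integral>\<^sup>+s. (\<integral>\<^sup>+d. (if j < s / r then gJ d j else gS (s / r)) \<partial>?D) \<partial>?E) \<partial>?E)"
    unfolding clock_law_def
    unfolding H_def[symmetric]
    by (simp add: ED.nn_integral_fst[OF H, symmetric] measure_pmf.nn_integral_fst[OF H', symmetric])
       (simp add: H_def)
  also have "\<dots> = (\<integral>\<^sup>+j. (\<integral>\<^sup>+s. (if j < s / r then G j else gS (s / r)) \<partial>?E) \<partial>?E)"
    by (intro nn_integral_cong) (simp add: nn_integral_pmf_of_set G_def add.commute)
  also have "\<dots> = (\<integral>\<^sup>+j. (\<integral>\<^sup>+s. G j * (if r * j < s then 1 else 0) + gS (s / r) * (if s / r \<le> j then 1 else 0) \<partial>?E) \<partial>?E)"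
    using r by (intro nn_integral_cong) (auto simp: indicator_def field_simps)
  also have "\<dots> = (\<integral>\<^sup>+j. (\<integral>\<^sup>+s. G j * (if r * j < s then 1 else 0) \<partial>?E) \<partial>?E) +
      (\<integral>\<^sup>+j. (\<integral>\<^sup>+s. gS (s / r) * (if s / r \<le> j then 1 else 0) \<partial>?E) \<partial>?E)"
    by (subst nn_integral_add[symmetric], measurable)
       (intro nn_integral_cong nn_integral_add, measurable)
  also have "(\<integral>\<^sup>+j. (\<integral>\<^sup>+s. gS (s / r) * (if s / r \<le> j then 1 else 0) \<partial>?E) \<partial>?E) =
      (\<integral>\<^sup>+s. (\<integral>\<^sup>+j. gS (s / r) * (if s / r \<le> j then 1 else 0) \<partial>?E) \<partial>?E)"
    by (rule EE.Fubini') measurable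
  also have "\<dots> = (\<integral>\<^sup>+s. gS (s / r) * ennreal (exp (- (s / r))) \<partial>?E)"
  proof (rule nn_integral_cong_AE)
    show "AE s in ?E. (\<integral>\<^sup>+j. gS (s / r) * (if s / r \<le> j then 1 else 0) \<partial>?E) = gS (s / r) * ennreal (exp (- (s / r)))"
      using AE_unit_exponential
    proof eventually_elim
      case (elim s)
      have "(\<lambda>j. gS (s / r) * (if s / r \<le> j then 1 else 0)) = (\<lambda>j. gS (s / r) * indicator {s / r..} j)"
        by (auto simp: indicator_def)
      with elim r show ?case
        by (simp add: nn_integral_cmult_indicator sets_unit_exponential emeasure_unit_exponential_atLeast)
    qed
  qed
  also have "\<dots> = (\<integral>\<^sup>+s. ennreal (exp (- s)) * (gS (s / r) * ennreal (exp (- (s / r)))) * indicator {0<..} s \<partial>lborel)"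
    by (rule nn_integral_unit_exponential) measurable
  also have "\<dots> = ennreal r * (\<integral>\<^sup>+s. ennreal (exp (- (r * s))) * (gS s * ennreal (exp (- s))) * indicator {0<..} s \<partial>lborel)"
    using r by (subst nn_integral_real_affine[where c=r and t=0])
      (auto simp: indicator_def zero_less_mult_iff intro!: arg_cong2[where f="(*)"] nn_integral_cong)
  also have "\<dots> = (\<integral>\<^sup>+s. ennreal (exp (- (1 + r) * s)) * (ennreal r * gS s) * indicator {0<..} s \<partial>lborel)"
    by (subst nn_integral_cmult[symmetric])
       (auto simp: ring_distribs exp_add exp_diff exp_minus divide_inverse ennreal_mult' mult_ac intro!: nn_integral_cong)
  also have "(\<integral>\<^sup>+j. (\<integral>\<^sup>+s. G j * (if r * j < s then 1 else 0) \<partial>?E) \<partial>?E) = (\<integral>\<^sup>+j. G j * ennreal (exp (- (r * j))) \<partial>?E)"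
  proof (rule nn_integral_cong_AE)
    show "AE j in ?E. (\<integral>\<^sup>+s. G j * (if r * j < s then 1 else 0) \<partial>?E) = G j * ennreal (exp (- (r * j)))"
      using AE_unit_exponential
    proof eventually_elim
      case (elim j)
      have "(\<lambda>s. G j * (if r * j < s then 1 else 0)) = (\<lambda>s. G j * indicator {r * j<..} s)"
        by (auto simp: indicator_def)
      with elim r show ?case
        by (simp add: nn_integral_cmult_indicator sets_unit_exponential emeasure_unit_exponential_greaterThan)
    qed
  qed
  also have "\<dots> = (\<integral>\<^sup>+s. ennreal (exp (- s)) * (G s * ennreal (exp (- (r * s)))) * indicator {0<..} s \<partial>lborel)"
    by (rule nn_integral_unit_exponential) measurable
  also have "\<dots> = (\<integral>\<^sup>+s. ennreal (exp (- (1 + r) * s)) * G s * indicator {0<..} s \<partial>lborel)"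
    by (auto simp: ring_distribs exp_add exp_diff exp_minus divide_inverse ennreal_mult' mult_ac intro!: nn_integral_cong)
  finally show ?thesis
    by (subst (asm) nn_integral_add[symmetric])
       (auto simp: G_def ring_distribs intro!: nn_integral_cong)
qed

section \<open>The branching property\<close>

definition env_shift :: "int \<Rightarrow> (int \<Rightarrow> real) \<Rightarrow> int \<Rightarrow> real" where
  "env_shift d \<xi> x = \<xi> (x + d)"

lemma env_shift_0 [simp]: "env_shift 0 \<xi> = \<xi>"
  by (simp add: env_shift_def fun_eq_iff)

lemma space_env_space [simp]: "space env_space = UNIV"
  by (simp add: space_PiM)

lemma measurable_env_apply: "(\<lambda>\<xi>. \<xi> x) \<in> borel_measurable env_space"
  using measurable_component_singleton[of x UNIV "\<lambda>_. borel"] by simp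

lemma measurable_env_shift [measurable (raw)]:
  assumes [measurable]: "f \<in> N \<rightarrow>\<^sub>M env_space"
  shows "(\<lambda>w. env_shift d (f w)) \<in> N \<rightarrow>\<^sub>M env_space"
  by (rule measurable_PiM_single')
     (auto simp: env_shift_def[abs_def] space_PiM intro!: measurable_compose[OF assms measurable_component_singleton])

text \<open>
  A subtree of the root is again a population started at \<open>0\<close>, with the environment seen from the
  place where the first sojourn ended. The induction is on the word, which grows at
  its head, while the root letter stays at its end.
\<close>

lemma
  fixes \<xi> :: "int \<Rightarrow> real" and c :: clocks and b :: bool
  defines "\<xi>' \<equiv> env_shift (site \<xi> c [b]) \<xi>" and "c' \<equiv> \<lambda>v. c (v @ [b])"
  shows site_subtree: "site \<xi> c (v @ [b]) = site \<xi> c [b] + site \<xi>' c' v"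
    and jumps_subtree: "jumps \<xi> c (v @ [b]) \<longleftrightarrow> jumps \<xi>' c' v"
    and sojourn_time_subtree: "sojourn_time \<xi> c (v @ [b]) = sojourn_time \<xi>' c' v"
proof -
  have site: "site \<xi> c (v @ [b]) = site \<xi> c [b] + site \<xi>' c' v" for v
  proof (induction v)
    case (Cons a v)
    have "\<xi> (site \<xi> c (v @ [b])) = \<xi>' (site \<xi>' c' v)"
      unfolding Cons by (simp add: \<xi>'_def env_shift_def add.commute)
    then show ?case
      unfolding append_Cons site.simps Cons
      by (simp add: jump_clock_def split_clock_def direction_def c'_def)
  qed simp
  then have "\<xi> (site \<xi> c (v @ [b])) = \<xi>' (site \<xi>' c' v)"
    by (simp add: \<xi>'_def env_shift_def add.commute)
  then show "site \<xi> c (v @ [b]) = site \<xi> c [b] + site \<xi>' c' v"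
    and "jumps \<xi> c (v @ [b]) \<longleftrightarrow> jumps \<xi>' c' v"
    and "sojourn_time \<xi> c (v @ [b]) = sojourn_time \<xi>' c' v"
    using site by (simp_all add: jumps_def sojourn_time_def jump_clock_def split_clock_def c'_def)
qed

lemma start_time_subtree:
  "start_time \<xi> c (v @ [b]) = sojourn_time \<xi> c [] +
     start_time (env_shift (site \<xi> c [b]) \<xi>) (\<lambda>v. c (v @ [b])) v"
  by (induction v) (simp_all add: sojourn_time_subtree)

lemma occurs_subtree:
  "occurs \<xi> c (v @ [b]) \<longleftrightarrow> (jumps \<xi> c [] \<longrightarrow> \<not> b) \<and>
     occurs (env_shift (site \<xi> c [b]) \<xi>) (\<lambda>v. c (v @ [b])) v"
  by (induction v) (auto simp: jumps_subtree)

lemma particles_subtree: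
  "v @ [b] \<in> particles \<xi> c t \<longleftrightarrow> (jumps \<xi> c [] \<longrightarrow> \<not> b) \<and>
     v \<in> particles (env_shift (site \<xi> c [b]) \<xi>) (\<lambda>v. c (v @ [b])) (t - sojourn_time \<xi> c [])"
  by (auto simp: particles_def occurs_subtree start_time_subtree sojourn_time_subtree)

text \<open>
  A negative clock, although of probability zero, would let time run backwards, so that a
  descendant could be alive before the sojourn of its ancestor has ended.
\<close>

definition positive_clocks :: "clocks \<Rightarrow> bool" where
  "positive_clocks c \<longleftrightarrow> (\<forall>u. 0 < fst (c u) \<and> 0 < fst (snd (c u)))"

lemma sojourn_time_nonneg:
  "positive_clocks c \<Longrightarrow> (\<forall>x. 0 < \<xi> x) \<Longrightarrow> 0 \<le> sojourn_time \<xi> c u"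
  by (auto simp: positive_clocks_def sojourn_time_def jump_clock_def split_clock_def less_imp_le)

lemma start_time_nonneg:
  assumes "positive_clocks c" "\<forall>x. 0 < \<xi> x"
  shows "0 \<le> start_time \<xi> c u"
  by (induction u) (auto intro!: add_nonneg_nonneg sojourn_time_nonneg assms)

lemma particles_before_0:
  assumes "positive_clocks c" "\<forall>x. 0 < \<xi> x" "t < 0"
  shows "particles \<xi> c t = {}"
proof -
  have "u \<notin> particles \<xi> c t" for u
    using start_time_nonneg[OF assms(1,2), of u] assms(3) by (simp add: particles_def)
  then show ?thesis by blast
qed

context
  fixes \<xi> :: "int \<Rightarrow> real" and j s :: real and d :: int and c c' :: clocks
begin

lemma jumps_graft_Nil: "jumps \<xi> (graft (j, s, d) c c') [] \<longleftrightarrow> j < s / \<xi> 0"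
  and sojourn_time_graft_Nil: "sojourn_time \<xi> (graft (j, s, d) c c') [] = min j (s / \<xi> 0)"
  and site_graft_single: "site \<xi> (graft (j, s, d) c c') [b] = (if j < s / \<xi> 0 then d else 0)"
  by (simp_all add: jumps_def sojourn_time_def jump_clock_def split_clock_def direction_def)

lemmas graft_Nil_simps = jumps_graft_Nil sojourn_time_graft_Nil site_graft_single

lemma particles_graft_before:
  assumes "positive_clocks c" "positive_clocks c'" "\<forall>x. 0 < \<xi> x" "0 \<le> t" "t < min j (s / \<xi> 0)"
  shows "particles \<xi> (graft (j, s, d) c c') t = {[]}"
proof -
  let ?g = "graft (j, s, d) c c'"
  have "u = []" if "u \<in> particles \<xi> ?g t" for u
  proof (cases u rule: rev_cases)
    case (snoc v b)
    have "particles (env_shift (site \<xi> ?g [b]) \<xi>) (\<lambda>v. ?g (v @ [b])) (t - sojourn_time \<xi> ?g []) = {}"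
      using assms by (intro particles_before_0; cases b) (auto simp: sojourn_time_graft_Nil env_shift_def)
    with that snoc show ?thesis by (simp add: particles_subtree)
  qed
  moreover have "[] \<in> particles \<xi> ?g t"
    using assms by (simp add: particles_def sojourn_time_graft_Nil)
  ultimately show ?thesis by blast
qed

lemma particles_graft_jump:
  assumes "j < s / \<xi> 0" "j \<le> t"
  shows "particles \<xi> (graft (j, s, d) c c') t = (\<lambda>v. v @ [False]) ` particles (env_shift d \<xi>) c (t - j)"
proof (intro set_eqI)
  fix u
  show "u \<in> particles \<xi> (graft (j, s, d) c c') t \<longleftrightarrow>
      u \<in> (\<lambda>v. v @ [False]) ` particles (env_shift d \<xi>) c (t - j)"
  proof (cases u rule: rev_cases)
    case Nil
    then show ?thesis using assms
      by (auto simp: particles_def sojourn_time_graft_Nil)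
  next
    case (snoc v b)
    then show ?thesis using assms
      by (cases b)
         (auto simp: particles_subtree graft_Nil_simps min_def simp del: site.simps)
  qed
qed

lemma particles_graft_split:
  assumes "\<not> j < s / \<xi> 0" "s / \<xi> 0 \<le> t"
  shows "particles \<xi> (graft (j, s, d) c c') t =
    (\<lambda>v. v @ [False]) ` particles \<xi> c (t - s / \<xi> 0) \<union> (\<lambda>v. v @ [True]) ` particles \<xi> c' (t - s / \<xi> 0)"
proof (intro set_eqI)
  fix u
  show "u \<in> particles \<xi> (graft (j, s, d) c c') t \<longleftrightarrow>
      u \<in> (\<lambda>v. v @ [False]) ` particles \<xi> c (t - s / \<xi> 0) \<union> (\<lambda>v. v @ [True]) ` particles \<xi> c' (t - s / \<xi> 0)"
  proof (cases u rule: rev_cases)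
    case Nil
    then show ?thesis using assms
      by (auto simp: particles_def sojourn_time_graft_Nil)
  next
    case (snoc v b)
    then show ?thesis using assms
      by (cases b)
         (auto simp: particles_subtree graft_Nil_simps min_def simp del: site.simps)
  qed
qed

lemma site_graft_False:
  "site \<xi> (graft (j, s, d) c c') (v @ [False]) =
    (if j < s / \<xi> 0 then d + site (env_shift d \<xi>) c v else site \<xi> c v)"
  by (simp add: site_subtree site_graft_single del: site.simps)

lemma site_graft_True:
  "\<not> j < s / \<xi> 0 \<Longrightarrow> site \<xi> (graft (j, s, d) c c') (v @ [True]) = site \<xi> c' v"
  by (simp add: site_subtree site_graft_single del: site.simps)

end

section \<open>The rightmost particle\<close>

definition rightmost :: "(int \<Rightarrow> real) \<Rightarrow> clocks \<Rightarrow> real \<Rightarrow> int" where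
  "rightmost \<xi> c t = Max (site \<xi> c ` particles \<xi> c t)"

text \<open>
  The maximum of an empty or infinite set is an unspecified constant. The identities below hold
  when the population is neither, which turns out to be almost surely the case.
\<close>

definition populated :: "(int \<Rightarrow> real) \<Rightarrow> clocks \<Rightarrow> real \<Rightarrow> bool" where
  "populated \<xi> c t \<longleftrightarrow> finite (particles \<xi> c t) \<and> particles \<xi> c t \<noteq> {}"

lemma max_particle_eq: "max_particle \<xi> c t = real_of_int (rightmost \<xi> c t)"
  by (simp add: max_particle_def rightmost_def)

lemma rightmost_graft_before:
  assumes "positive_clocks c" "positive_clocks c'" "\<forall>x. 0 < \<xi> x" "0 \<le> t" "t < min j (s / \<xi> 0)"
  shows "rightmost \<xi> (graft (j, s, d) c c') t = 0"
  using particles_graft_before[where j=j and s=s and \<xi>=\<xi> and c=c and c'=c' and d=d and t=t] assms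
  by (simp add: rightmost_def)

lemma rightmost_graft_jump:
  assumes "j < s / \<xi> 0" "j \<le> t" "populated (env_shift d \<xi>) c (t - j)"
  shows "rightmost \<xi> (graft (j, s, d) c c') t = d + rightmost (env_shift d \<xi>) c (t - j)"
proof -
  have "site \<xi> (graft (j, s, d) c c') ` particles \<xi> (graft (j, s, d) c c') t =
      (+) d ` (site (env_shift d \<xi>) c ` particles (env_shift d \<xi>) c (t - j))"
    using assms(1,2) by (simp add: particles_graft_jump image_image site_graft_False)
  then show ?thesis
    using assms(3) unfolding rightmost_def populated_def
    by (simp add: mono_Max_commute[of "(+) d", symmetric] mono_def)
qed

lemma rightmost_graft_split:
  assumes "\<not> j < s / \<xi> 0" "s / \<xi> 0 \<le> t"
    and "populated \<xi> c (t - s / \<xi> 0)" "populated \<xi> c' (t - s / \<xi> 0)"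
  shows "rightmost \<xi> (graft (j, s, d) c c') t =
    max (rightmost \<xi> c (t - s / \<xi> 0)) (rightmost \<xi> c' (t - s / \<xi> 0))"
  using assms unfolding rightmost_def populated_def
  by (simp add: particles_graft_split image_Un image_image site_graft_False site_graft_True Max_Un)

section \<open>Measurability in the environment, the clocks and the time\<close>

lemma measurable_apply_countable:
  assumes [measurable]: "f \<in> N \<rightarrow>\<^sub>M env_space" "k \<in> N \<rightarrow>\<^sub>M count_space UNIV"
  shows "(\<lambda>w. f w (k w)) \<in> borel_measurable N"
  by (rule measurable_compose_countable[where f="\<lambda>i w. f w i"])
     (auto intro!: measurable_compose[OF assms(1) measurable_component_singleton])

lemma measurable_clock_component:
  assumes "g \<in> N \<rightarrow>\<^sub>M clock_space"
  shows "(\<lambda>w. g w u) \<in> N \<rightarrow>\<^sub>M borel \<Otimes>\<^sub>M (borel \<Otimes>\<^sub>M count_space UNIV)"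
proof -
  have "g \<in> N \<rightarrow>\<^sub>M (\<Pi>\<^sub>M u\<in>UNIV. (borel \<Otimes>\<^sub>M (borel \<Otimes>\<^sub>M count_space UNIV)))"
    using assms unfolding measurable_cong_sets[OF refl sets_clock_space] .
  from measurable_compose[OF this measurable_component_singleton] show ?thesis by simp
qed

context
  fixes f :: "'b \<Rightarrow> int \<Rightarrow> real" and g :: "'b \<Rightarrow> clocks" and h :: "'b \<Rightarrow> real" and N :: "'b measure"
  assumes f [measurable]: "f \<in> N \<rightarrow>\<^sub>M env_space" and g [measurable]: "g \<in> N \<rightarrow>\<^sub>M clock_space"
begin

lemma measurable_site [measurable (raw)]: "(\<lambda>w. site (f w) (g w) u) \<in> N \<rightarrow>\<^sub>M count_space UNIV"
proof (induction u)
  case (Cons b u)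
  note [measurable] = Cons measurable_clock_component[OF g]
  have [measurable]: "(\<lambda>w. f w (site (f w) (g w) u)) \<in> borel_measurable N"
    by (rule measurable_apply_countable) measurable
  show ?case
    unfolding site.simps jump_clock_def split_clock_def direction_def by measurable
qed simp

lemma measurable_clocks_at_site:
  "(\<lambda>w. jump_clock (g w) u) \<in> borel_measurable N"
  "(\<lambda>w. split_clock (f w (site (f w) (g w) u)) (g w) u) \<in> borel_measurable N"
proof -
  note [measurable] = measurable_clock_component[OF g]
  have [measurable]: "(\<lambda>w. f w (site (f w) (g w) u)) \<in> borel_measurable N"
    by (rule measurable_apply_countable) measurable
  show "(\<lambda>w. jump_clock (g w) u) \<in> borel_measurable N"
    "(\<lambda>w. split_clock (f w (site (f w) (g w) u)) (g w) u) \<in> borel_measurable N"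
    unfolding jump_clock_def split_clock_def by measurable
qed

lemma measurable_jumps [measurable (raw)]: "Measurable.pred N (\<lambda>w. jumps (f w) (g w) u)"
  unfolding jumps_def using measurable_clocks_at_site by measurable

lemma measurable_sojourn_time [measurable (raw)]: "(\<lambda>w. sojourn_time (f w) (g w) u) \<in> borel_measurable N"
  unfolding sojourn_time_def using measurable_clocks_at_site by measurable

lemma measurable_start_time [measurable (raw)]: "(\<lambda>w. start_time (f w) (g w) u) \<in> borel_measurable N"
  by (induction u) simp_all

lemma measurable_occurs [measurable (raw)]: "Measurable.pred N (\<lambda>w. occurs (f w) (g w) u)"
  by (induction u) simp_all

context
  assumes h [measurable]: "h \<in> borel_measurable N"
begin

lemma measurable_in_particles [measurable (raw)]:
  "Measurable.pred N (\<lambda>w. u \<in> particles (f w) (g w) (h w))"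
  unfolding particles_def by simp

text \<open>
  Measurability on the whole space requires the default value of the maximum as well: it takes the
  same value on infinite sets as on the empty set.
\<close>

lemma measurable_rightmost [measurable (raw)]:
  "(\<lambda>w. rightmost (f w) (g w) (h w)) \<in> N \<rightarrow>\<^sub>M count_space UNIV"
proof -
  define S where "S w = site (f w) (g w) ` particles (f w) (g w) (h w)" for w
  have S [measurable]: "Measurable.pred N (\<lambda>w. k \<in> S w)" for k
  proof -
    have "k \<in> S w \<longleftrightarrow> (\<exists>u. u \<in> particles (f w) (g w) (h w) \<and> site (f w) (g w) u = k)" for w
      by (auto simp: S_def)
    then show ?thesis by simp
  qed
  define P where "P w \<longleftrightarrow> (\<exists>m. m \<in> S w) \<and> (\<exists>n::int. \<forall>m. m \<in> S w \<longrightarrow> \<bar>m\<bar> \<le> n)" for w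
  have P [measurable]: "Measurable.pred N P"
    unfolding P_def by measurable
  have P_iff: "P w \<longleftrightarrow> S w \<noteq> {} \<and> finite (S w)" for w
  proof -
    have "finite (S w)" if "\<forall>m. m \<in> S w \<longrightarrow> \<bar>m\<bar> \<le> n" for n
      by (rule finite_subset[of _ "{-n..n}"]) (use that in \<open>auto simp: abs_le_iff minus_le_iff\<close>)
    moreover have "\<exists>n. \<forall>m. m \<in> S w \<longrightarrow> \<bar>m\<bar> \<le> n" if "finite (S w)"
      using that Max_ge[of "abs ` S w"] by (intro exI[of _ "Max (abs ` S w)"]) auto
    ultimately show ?thesis by (auto simp: P_def)
  qed
  have bad: "Max (S w) = Max {}" if "\<not> P w" for w
    using that Max.infinite[of "S w"] Max.eq_fold'[of "{} :: int set"] by (auto simp: P_iff)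
  have "Measurable.pred N (\<lambda>w. rightmost (f w) (g w) (h w) = k)" for k
  proof -
    have "rightmost (f w) (g w) (h w) = k \<longleftrightarrow>
        (P w \<and> k \<in> S w \<and> (\<forall>m. m \<in> S w \<longrightarrow> m \<le> k)) \<or> (\<not> P w \<and> Max {} = k)" for w
    proof (cases "P w")
      case True
      then show ?thesis
        unfolding rightmost_def S_def[symmetric] by (auto simp: P_iff Max_eq_iff)
    qed (simp add: rightmost_def S_def[symmetric] bad)
    then show ?thesis by simp
  qed
  then show ?thesis
    by (simp add: measurable_count_space_eq_countable pred_def vimage_def Int_def conj_commute)
qed

end
end

section \<open>Decomposition at the first sojourn\<close>

lemma AE_clock_law_positive: "AE x in clock_law. 0 < fst x \<and> 0 < fst (snd x)"
proof -
  interpret E: prob_space unit_exponential by (rule prob_space_unit_exponential)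
  interpret D: prob_space "measure_pmf (pmf_of_set {-1, 1 :: int})" by (rule prob_space_measure_pmf)
  interpret ED: pair_prob_space unit_exponential "measure_pmf (pmf_of_set {-1, 1 :: int})" ..
  interpret EED: pair_prob_space unit_exponential "unit_exponential \<Otimes>\<^sub>M measure_pmf (pmf_of_set {-1, 1 :: int})" ..
  let ?D = "measure_pmf (pmf_of_set {-1, 1 :: int})"
  have [measurable]: "Measurable.pred unit_exponential (\<lambda>s. 0 < s)"
    unfolding measurable_cong_sets[OF sets_unit_exponential refl] by measurable
  have "AE q in unit_exponential \<Otimes>\<^sub>M ?D. 0 < fst q"
  proof (rule ED.AE_pair_measure)
    show "{q \<in> space (unit_exponential \<Otimes>\<^sub>M ?D). 0 < fst q} \<in> sets (unit_exponential \<Otimes>\<^sub>M ?D)"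
      by measurable
    show "AE s in unit_exponential. AE d in ?D. 0 < fst (s, d)"
      using AE_unit_exponential by simp
  qed
  then have "AE j in unit_exponential. AE q in unit_exponential \<Otimes>\<^sub>M ?D. 0 < fst (j, q) \<and> 0 < fst (snd (j, q))"
    using AE_unit_exponential by simp
  then show ?thesis
    unfolding clock_law_def by (intro EED.AE_pair_measure) measurable
qed

lemma AE_positive_clocks: "AE c in clock_space. positive_clocks c"
proof -
  have "AE c in clock_space. 0 < fst (c u) \<and> 0 < fst (snd (c u))" for u
    unfolding clock_space_eq by (rule clocks.AE_component[OF UNIV_I AE_clock_law_positive])
  then show ?thesis
    unfolding positive_clocks_def by (simp add: AE_all_countable)
qed

lemma measurable_rightmost_fun:
  assumes "f \<in> N \<rightarrow>\<^sub>M env_space" "g \<in> N \<rightarrow>\<^sub>M clock_space" "h \<in> borel_measurable N"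
  shows "(\<lambda>w. F (rightmost (f w) (g w) (h w))) \<in> borel_measurable N"
  by (rule measurable_compose[OF measurable_rightmost[OF assms]]) simp

text \<open>
  All integral equations below are instances of this formula. Here \<open>gJ d s\<close> and \<open>gS s\<close> are the
  conditional means of \<open>\<Phi>\<close> when the first sojourn ends at time \<open>s\<close> with a jump in direction \<open>d\<close>,
  respectively with a split.
\<close>

lemma first_sojourn:
  fixes \<xi> :: "int \<Rightarrow> real" and \<Phi> :: "clocks \<Rightarrow> ennreal"
  assumes r: "0 < \<xi> 0"
    and [measurable]: "\<Phi> \<in> borel_measurable clock_space"
    and gJ: "\<And>d. gJ d \<in> borel_measurable borel" and gS: "gS \<in> borel_measurable borel"
    and eq: "\<And>j s d. 0 < j \<Longrightarrow> 0 < s \<Longrightarrow>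
      (\<integral>\<^sup>+c. \<integral>\<^sup>+c'. \<Phi> (graft (j, s, d) c c') \<partial>clock_space \<partial>clock_space) =
      (if j < s / \<xi> 0 then gJ d j else gS (s / \<xi> 0))"
  shows "(\<integral>\<^sup>+c. \<Phi> c \<partial>clock_space) =
    (\<integral>\<^sup>+s. ennreal (exp (- (1 + \<xi> 0) * s)) *
      ((gJ 1 s + gJ (-1) s) / 2 + ennreal (\<xi> 0) * gS s) * indicator {0<..} s \<partial>lborel)"
proof -
  have "(\<integral>\<^sup>+c. \<Phi> c \<partial>clock_space) =
      (\<integral>\<^sup>+(j, s, d). (if j < s / \<xi> 0 then gJ d j else gS (s / \<xi> 0)) \<partial>clock_law)"
    unfolding nn_integral_clock_space[OF assms(2)]
  proof (rule nn_integral_cong_AE)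
    show "AE x in clock_law. (\<integral>\<^sup>+c. \<integral>\<^sup>+c'. \<Phi> (graft x c c') \<partial>clock_space \<partial>clock_space) =
        (case x of (j, s, d) \<Rightarrow> if j < s / \<xi> 0 then gJ d j else gS (s / \<xi> 0))"
      using AE_clock_law_positive by eventually_elim (auto simp: eq)
  qed
  then show ?thesis using exponential_race[OF r gJ gS] by simp
qed

section \<open>Exponential moments and finiteness of the population\<close>

text \<open>
  The expected value of \<open>\<Sum> exp (\<theta> * site)\<close> over all particles solves a linear renewal equation, and
  \<open>exp ((cosh \<theta> - 1 + b) * t)\<close> is a supersolution of it. To conclude that the expectation lies below, the
  tree is truncated: for the words of length less than \<open>n\<close> the comparison is an induction on \<open>n\<close>,
  and monotone convergence does the rest.
\<close>

definition short_moment :: "nat \<Rightarrow> real \<Rightarrow> (int \<Rightarrow> real) \<Rightarrow> clocks \<Rightarrow> real \<Rightarrow> ennreal" where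
  "short_moment n \<theta> \<xi> c t =
     (\<Sum>u | length u < n. ennreal (exp (\<theta> * site \<xi> c u)) * indicator (particles \<xi> c t) u)"

lemma finite_short_words: "finite {u :: bool list. length u < n}"
  by (rule finite_subset[OF _ finite_lists_length_le[of UNIV n]]) auto

lemma sum_short_words_Suc:
  fixes F :: "bool list \<Rightarrow> 'a :: comm_monoid_add"
  shows "(\<Sum>u | length u < Suc n. F u) =
    F [] + (\<Sum>u | length u < n. F (u @ [False]) + F (u @ [True]))"
proof -
  let ?W = "{u :: bool list. length u < n}"
  let ?S = "\<lambda>b. (\<lambda>v. v @ [b]) ` ?W"
  have "u \<in> insert [] (?S False \<union> ?S True)" if "length u < Suc n" for u :: "bool list"
  proof (cases u rule: rev_cases)
    case (snoc v b) then show ?thesis using that by (cases b) auto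
  qed auto
  then have "{u. length u < Suc n} = insert [] (?S False \<union> ?S True)"
    by auto
  moreover have "sum F (?S b) = (\<Sum>v\<in>?W. F (v @ [b]))" for b
    by (subst sum.reindex) (auto simp: inj_on_def)
  moreover have "sum F (insert [] (?S False \<union> ?S True)) = F [] + (sum F (?S False) + sum F (?S True))"
  proof -
    have "sum F (?S False \<union> ?S True) = sum F (?S False) + sum F (?S True)"
      using finite_short_words[of n] by (intro sum.union_disjoint) auto
    then show ?thesis
      using finite_short_words[of n] by (subst sum.insert) auto
  qed
  ultimately show ?thesis by (simp add: sum.distrib)
qed

lemma measurable_short_moment [measurable (raw)]:
  assumes [measurable]: "f \<in> N \<rightarrow>\<^sub>M env_space" "g \<in> N \<rightarrow>\<^sub>M clock_space" "h \<in> borel_measurable N"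
  shows "(\<lambda>w. short_moment n \<theta> (f w) (g w) (h w)) \<in> borel_measurable N"
proof -
  have "(indicator (particles (f w) (g w) (h w)) u :: ennreal) =
      (if u \<in> particles (f w) (g w) (h w) then 1 else 0)" for w u
    by (simp add: indicator_def)
  then show ?thesis unfolding short_moment_def by simp
qed

lemma short_moment_before_0:
  "positive_clocks c \<Longrightarrow> \<forall>x. 0 < \<xi> x \<Longrightarrow> t < 0 \<Longrightarrow> short_moment n \<theta> \<xi> c t = 0"
  by (simp add: short_moment_def particles_before_0)

lemma short_moment_graft:
  fixes \<theta> :: real
  assumes "0 \<le> t"
  shows "short_moment (Suc n) \<theta> \<xi> (graft (j, s, d) c c') t =
    (if j < s / \<xi> 0
     then (if t < j then 1 else 0) + ennreal (exp (\<theta> * d)) * short_moment n \<theta> (env_shift d \<xi>) c (t - j)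
     else (if t < s / \<xi> 0 then 1 else 0) +
       (short_moment n \<theta> \<xi> c (t - s / \<xi> 0) + short_moment n \<theta> \<xi> c' (t - s / \<xi> 0)))"
proof -
  let ?g = "graft (j, s, d) c c'"
  have Nil: "(indicator (particles \<xi> ?g t) [] :: ennreal) = (if t < min j (s / \<xi> 0) then 1 else 0)"
    using assms by (simp add: indicator_def particles_def sojourn_time_graft_Nil)
  have ind: "(indicator (particles \<xi> ?g t) (v @ [b]) :: ennreal) =
    (if j < s / \<xi> 0 then (if b then 0 else indicator (particles (env_shift d \<xi>) c (t - j)) v)
     else indicator (particles \<xi> (if b then c' else c) (t - s / \<xi> 0)) v)" for v b
    by (cases b) (auto simp: indicator_def particles_subtree graft_Nil_simps min_def simp del: site.simps)
  show ?thesis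
  proof (cases "j < s / \<xi> 0")
    case True
    then show ?thesis
      by (simp add: short_moment_def sum_short_words_Suc Nil ind site_graft_False sum_distrib_left
        ring_distribs exp_add ennreal_mult' mult.assoc)
  next
    case False
    then show ?thesis
      by (simp add: short_moment_def sum_short_words_Suc Nil ind site_graft_False site_graft_True
          sum.distrib)
  qed
qed

text \<open>
  By induction the integrand of the renewal equation is at most the derivative of an explicit
  function: \<open>\<kappa> = cosh \<theta> - 1 + b\<close> is chosen such that \<open>cosh \<theta> + 2 * \<xi> 0 \<le> \<kappa> + (1 + \<xi> 0)\<close>, where the
  left-hand side collects the weights of the two jumps and of the two children, and the right-hand
  side is what \<open>exp (\<kappa> * t)\<close> can absorb.
\<close>

lemma short_moment_le:
  assumes "\<forall>x. 0 < \<xi> x" "\<forall>x. \<xi> x \<le> b" "0 \<le> t"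
  shows "(\<integral>\<^sup>+c. short_moment n \<theta> \<xi> c t \<partial>clock_space) \<le> ennreal (exp ((cosh \<theta> - 1 + b) * t))"
  using assms
proof (induction n arbitrary: \<xi> t)
  case 0
  then show ?case by (simp add: short_moment_def)
next
  case (Suc n)
  define \<kappa> where "\<kappa> = cosh \<theta> - 1 + b"
  define l where "l = 1 + \<xi> 0"
  define z where "z \<zeta> s = (\<integral>\<^sup>+c. short_moment n \<theta> \<zeta> c s \<partial>clock_space)" for \<zeta> s
  have r: "0 < \<xi> 0" "0 < l" "0 \<le> \<kappa>" "cosh \<theta> + 2 * \<xi> 0 \<le> \<kappa> + l"
    using Suc.prems(1,2)[rule_format, of 0] cosh_real_ge_1[of \<theta>] by (auto simp: \<kappa>_def l_def)
  have [measurable]: "(\<lambda>s. z \<zeta> (h s)) \<in> borel_measurable borel"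
    if [measurable]: "h \<in> borel_measurable borel" for \<zeta> :: "int \<Rightarrow> real" and h :: "real \<Rightarrow> real"
    unfolding z_def by measurable
  have z_le: "z \<zeta> s \<le> ennreal (exp (\<kappa> * s)) * indicator {0..} s"
    if \<zeta>: "\<forall>x. 0 < \<zeta> x" "\<forall>x. \<zeta> x \<le> b" for \<zeta> s
  proof (cases "0 \<le> s")
    case False
    have "AE c in clock_space. short_moment n \<theta> \<zeta> c s = 0"
      using AE_positive_clocks by eventually_elim (use False \<zeta> in \<open>simp add: short_moment_before_0\<close>)
    then have "z \<zeta> s = 0"
      unfolding z_def by (subst nn_integral_0_iff_AE) auto
    then show ?thesis by simp
  qed (use Suc.IH[OF \<zeta>] in \<open>auto simp: z_def \<kappa>_def\<close>)
  define gJ where "gJ d s = (if t < s then 1 else 0) + ennreal (exp (\<theta> * d)) * z (env_shift d \<xi>) (t - s)"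
    for d :: int and s
  define gS where "gS s = (if t < s then 1 else 0) + (z \<xi> (t - s) + z \<xi> (t - s))" for s
  let ?e = "\<lambda>s. ennreal (exp (\<kappa> * (t - s))) * indicator {..t} s"
  have J: "gJ d s \<le> (if t < s then 1 else 0) + ennreal (exp (\<theta> * d)) * ?e s" for d s
    unfolding gJ_def using Suc.prems z_le[of "env_shift d \<xi>" "t - s"]
    by (intro add_left_mono mult_left_mono) (auto simp: env_shift_def indicator_def)
  have S: "gS s \<le> (if t < s then 1 else 0) + 2 * ?e s" for s
    unfolding gS_def mult_2 using Suc.prems z_le[of "\<xi>" "t - s"]
    by (intro add_left_mono add_mono) (auto simp: indicator_def)
  have "(\<integral>\<^sup>+c. short_moment (Suc n) \<theta> \<xi> c t \<partial>clock_space) =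
    (\<integral>\<^sup>+s. ennreal (exp (- (1 + \<xi> 0) * s)) *
      ((gJ 1 s + gJ (-1) s) / 2 + ennreal (\<xi> 0) * gS s) * indicator {0<..} s \<partial>lborel)"
  proof (rule first_sojourn)
    show "(\<integral>\<^sup>+c. \<integral>\<^sup>+c'. short_moment (Suc n) \<theta> \<xi> (graft (j, s, d) c c') t \<partial>clock_space \<partial>clock_space) =
      (if j < s / \<xi> 0 then gJ d j else gS (s / \<xi> 0))" for j s d
      using Suc.prems(3)
      by (simp add: short_moment_graft gJ_def gS_def z_def nn_integral_add nn_integral_cmult
          clock_space.emeasure_space_1)
    show "gJ d \<in> borel_measurable borel" for d
      unfolding gJ_def by measurable
    show "gS \<in> borel_measurable borel"
      unfolding gS_def by measurable
  qed (use r in simp_all)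
  also have "\<dots> \<le> (\<integral>\<^sup>+s. ennreal (l * exp (- l * s)) * indicator {t..} s +
      ennreal ((\<kappa> + l) * exp (\<kappa> * t - (\<kappa> + l) * s)) * indicator {0..t} s \<partial>lborel)"
  proof (rule nn_integral_mono)
    fix s :: real
    have ineq: "(gJ 1 s + gJ (-1) s) / 2 + ennreal (\<xi> 0) * gS s \<le>
       (if t < s then ennreal l else ennreal ((\<kappa> + l) * exp (\<kappa> * (t - s))))"
    proof -
      have "(gJ 1 s + gJ (-1) s) / 2 + ennreal (\<xi> 0) * gS s \<le>
        (((if t < s then 1 else 0) + ennreal (exp (\<theta> * 1)) * ?e s) +
         ((if t < s then 1 else 0) + ennreal (exp (\<theta> * (-1))) * ?e s)) / 2 +
         ennreal (\<xi> 0) * ((if t < s then 1 else 0) + 2 * ?e s)"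
        using J[of 1 s] J[of "-1" s] S[of s]
        by (intro add_mono divide_right_mono_ennreal mult_left_mono) auto
      also have "\<dots> = (if t < s then ennreal l else ennreal ((cosh \<theta> + 2 * \<xi> 0) * exp (\<kappa> * (t - s))))"
      proof (cases "t < s")
        case True
        with r show ?thesis by (simp add: l_def)
      next
        case False
        let ?x = "exp (\<kappa> * (t - s))"
        have "(ennreal (exp \<theta>) * ennreal ?x + ennreal (exp (- \<theta>)) * ennreal ?x) / 2 +
            ennreal (\<xi> 0) * (2 * ennreal ?x) =
            ennreal ((exp \<theta> * ?x + exp (- \<theta>) * ?x) / 2 + \<xi> 0 * (2 * ?x))"
          using r by (simp add: ennreal_mult[symmetric] numeral_mult_ennreal ennreal_plus[symmetric]
              ennreal_divide_numeral del: ennreal_plus)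
        also have "(exp \<theta> * ?x + exp (- \<theta>) * ?x) / 2 + \<xi> 0 * (2 * ?x) = (cosh \<theta> + 2 * \<xi> 0) * ?x"
          by (simp add: cosh_def field_simps)
        finally show ?thesis using False by simp
      qed
      also have "\<dots> \<le> (if t < s then ennreal l else ennreal ((\<kappa> + l) * exp (\<kappa> * (t - s))))"
        using r by (auto intro!: ennreal_leI mult_right_mono)
      finally show ?thesis .
    qed
    show "ennreal (exp (- (1 + \<xi> 0) * s)) *
      ((gJ 1 s + gJ (-1) s) / 2 + ennreal (\<xi> 0) * gS s) * indicator {0<..} s \<le>
      ennreal (l * exp (- l * s)) * indicator {t..} s +
      ennreal ((\<kappa> + l) * exp (\<kappa> * t - (\<kappa> + l) * s)) * indicator {0..t} s"
    proof (cases "0 < s")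
      case True
      then have "ennreal (exp (- (1 + \<xi> 0) * s)) *
          ((gJ 1 s + gJ (-1) s) / 2 + ennreal (\<xi> 0) * gS s) * indicator {0<..} s \<le>
        ennreal (exp (- l * s)) * (if t < s then ennreal l else ennreal ((\<kappa> + l) * exp (\<kappa> * (t - s))))"
        using ineq by (auto simp: l_def intro!: mult_left_mono)
      also have "\<dots> = (if t < s then ennreal (l * exp (- l * s)) else
          ennreal ((\<kappa> + l) * exp (\<kappa> * t - (\<kappa> + l) * s)))"
      proof -
        have e: "exp (\<kappa> * t - (\<kappa> + l) * s) = exp (- l * s) * exp (\<kappa> * (t - s))"
          by (simp add: exp_add[symmetric] algebra_simps)
        show ?thesis
          using r unfolding e by (simp add: ennreal_mult[symmetric] mult_ac)
      qed
      also have "\<dots> \<le> ennreal (l * exp (- l * s)) * indicator {t..} s +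
          ennreal ((\<kappa> + l) * exp (\<kappa> * t - (\<kappa> + l) * s)) * indicator {0..t} s"
        using True by (auto simp: indicator_def)
      finally show ?thesis .
    qed simp
  qed
  also have "\<dots> = ennreal (exp (- l * t)) + ennreal ((- exp (\<kappa> * t - (\<kappa> + l) * t)) - (- exp (\<kappa> * t - (\<kappa> + l) * 0)))"
    using r Suc.prems(3)
    by (subst nn_integral_add, simp, simp)
       (intro arg_cong2[where f="(+)"] nn_integral_exponential_atLeast nn_integral_FTC_Icc;
         (auto intro!: derivative_eq_intros simp: algebra_simps)?)
  also have "\<dots> = ennreal (exp (\<kappa> * t))"
  proof -
    have "0 \<le> \<kappa> * t" "0 \<le> l * t" using r Suc.prems(3) by auto
    then show ?thesis
      by (subst ennreal_plus[symmetric]) (auto simp: ring_distribs)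
  qed
  finally show ?case by (simp add: \<kappa>_def)
qed


definition exp_moment :: "real \<Rightarrow> (int \<Rightarrow> real) \<Rightarrow> clocks \<Rightarrow> real \<Rightarrow> ennreal" where
  "exp_moment \<theta> \<xi> c t =
     (\<integral>\<^sup>+u. ennreal (exp (\<theta> * site \<xi> c u)) * indicator (particles \<xi> c t) u \<partial>count_space UNIV)"

lemma exp_moment_eq_SUP: "exp_moment \<theta> \<xi> c t = (SUP n. short_moment n \<theta> \<xi> c t)"
proof -
  let ?F = "\<lambda>u. ennreal (exp (\<theta> * site \<xi> c u)) * indicator (particles \<xi> c t) u"
  have "?F u = (SUP n. ?F u * indicator {u. length u < n} u)" for u
  proof (rule antisym)
    show "?F u \<le> (SUP n. ?F u * indicator {u. length u < n} u)"
      by (rule SUP_upper2[of "Suc (length u)"]) auto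
  qed (auto intro!: SUP_least simp: indicator_def)
  then have "exp_moment \<theta> \<xi> c t = (\<integral>\<^sup>+u. (SUP n. ?F u * indicator {u. length u < n} u) \<partial>count_space UNIV)"
    unfolding exp_moment_def by presburger
  also have "\<dots> = (SUP n. \<integral>\<^sup>+u. ?F u * indicator {u. length u < n} u \<partial>count_space UNIV)"
    by (rule nn_integral_monotone_convergence_SUP)
       (auto simp: incseq_def le_fun_def indicator_def)
  also have "\<dots> = (SUP n. short_moment n \<theta> \<xi> c t)"
  proof (intro SUP_cong refl)
    show "(\<integral>\<^sup>+u. ?F u * indicator {u. length u < n} u \<partial>count_space UNIV) = short_moment n \<theta> \<xi> c t" for n
      unfolding short_moment_def
      by (subst nn_integral_count_space'[OF finite_short_words[of n]]) auto
  qed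
  finally show ?thesis .
qed

lemma exp_moment_le:
  assumes "\<forall>x. 0 < \<xi> x" "\<forall>x. \<xi> x \<le> b" "0 \<le> t"
  shows "(\<integral>\<^sup>+c. exp_moment \<theta> \<xi> c t \<partial>clock_space) \<le> ennreal (exp ((cosh \<theta> - 1 + b) * t))"
proof -
  have "incseq (\<lambda>n c. short_moment n \<theta> \<xi> c t)"
    unfolding short_moment_def incseq_def le_fun_def
    by (auto intro!: sum_mono2 finite_short_words)
  then have "(\<integral>\<^sup>+c. exp_moment \<theta> \<xi> c t \<partial>clock_space) = (SUP n. \<integral>\<^sup>+c. short_moment n \<theta> \<xi> c t \<partial>clock_space)"
    unfolding exp_moment_eq_SUP by (intro nn_integral_monotone_convergence_SUP) auto
  also have "\<dots> \<le> ennreal (exp ((cosh \<theta> - 1 + b) * t))"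
    by (rule SUP_least) (rule short_moment_le[OF assms])
  finally show ?thesis .
qed

lemma measurable_exp_moment: "(\<lambda>c. exp_moment \<theta> \<xi> c t) \<in> borel_measurable clock_space"
  unfolding exp_moment_eq_SUP by measurable

lemma finite_particles:
  assumes "exp_moment 0 \<xi> c t < \<infinity>"
  shows "finite (particles \<xi> c t)"
  using assms by (simp add: exp_moment_def emeasure_count_space split: if_splits)

lemma exp_site_le_exp_moment:
  fixes \<theta> :: real
  assumes "u \<in> particles \<xi> c t"
  shows "ennreal (exp (\<theta> * site \<xi> c u)) \<le> exp_moment \<theta> \<xi> c t"
proof -
  have "ennreal (exp (\<theta> * site \<xi> c u)) =
      (\<integral>\<^sup>+v. ennreal (exp (\<theta> * site \<xi> c u)) * indicator {u} v \<partial>count_space UNIV)"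
    by (subst nn_integral_cmult_indicator) (auto simp: emeasure_count_space)
  also have "\<dots> \<le> exp_moment \<theta> \<xi> c t"
    unfolding exp_moment_def using assms
    by (intro nn_integral_mono) (auto simp: indicator_def)
  finally show ?thesis .
qed

text \<open>
  The line of descent that always takes the successor \<open>False\<close> exists whatever happens, so the
  population is non-empty as long as this line has infinitely many sojourns of infinite total
  length. Each sojourn is exponential with rate at most \<open>1 + b\<close> and multiplies the Laplace transform at
  \<open>1\<close> of the elapsed time by at most \<open>(1 + b) / (2 + b) < 1\<close>.
\<close>

lemma spine_start_time_laplace:
  assumes "\<forall>x. 0 < \<xi> x" "\<forall>x. \<xi> x \<le> b"
  shows "(\<integral>\<^sup>+c. ennreal (exp (- start_time \<xi> c (replicate n False))) \<partial>clock_space) \<le>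
    ennreal (((1 + b) / (2 + b)) ^ n)"
  using assms
proof (induction n arbitrary: \<xi>)
  case (Suc n)
  let ?\<rho> = "(1 + b) / (2 + b)"
  define w where "w \<zeta> = (\<integral>\<^sup>+c. ennreal (exp (- start_time \<zeta> c (replicate n False))) \<partial>clock_space)" for \<zeta>
  define l where "l = 1 + \<xi> 0"
  have l: "0 < \<xi> 0" "\<xi> 0 \<le> b" "0 < b"
    using Suc.prems[rule_format, of 0] by auto
  have w: "w \<zeta> \<le> ennreal (?\<rho> ^ n)" if "\<forall>x. 0 < \<zeta> x" "\<forall>x. \<zeta> x \<le> b" for \<zeta>
    using Suc.IH[OF that] by (simp add: w_def)
  have start: "start_time \<xi> (graft (j, s, d) c c') (replicate (Suc n) False) =
      (if j < s / \<xi> 0 then j + start_time (env_shift d \<xi>) c (replicate n False)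
       else s / \<xi> 0 + start_time \<xi> c (replicate n False))" for j s d c c'
    unfolding replicate_append_same[symmetric] replicate.simps
    by (simp add: start_time_subtree graft_Nil_simps del: site.simps start_time.simps)
  have "(\<integral>\<^sup>+c. ennreal (exp (- start_time \<xi> c (replicate (Suc n) False))) \<partial>clock_space) =
    (\<integral>\<^sup>+s. ennreal (exp (- (1 + \<xi> 0) * s)) *
      ((ennreal (exp (- s)) * w (env_shift 1 \<xi>) + ennreal (exp (- s)) * w (env_shift (-1) \<xi>)) / 2 +
       ennreal (\<xi> 0) * (ennreal (exp (- s)) * w \<xi>)) * indicator {0<..} s \<partial>lborel)"
    by (rule first_sojourn)
       (use l in \<open>simp_all add: start w_def exp_add exp_diff exp_minus ennreal_mult' nn_integral_cmult
         del: replicate.simps start_time.simps\<close>)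
  also have "\<dots> \<le> (\<integral>\<^sup>+s. ennreal ((1 + \<xi> 0) / (2 + \<xi> 0) * ?\<rho> ^ n) *
      (ennreal ((2 + \<xi> 0) * exp (- (2 + \<xi> 0) * s)) * indicator {0..} s) \<partial>lborel)"
  proof (rule nn_integral_mono)
    fix s :: real
    let ?e = "ennreal (exp (- s))" and ?p = "ennreal (?\<rho> ^ n)"
    have \<rho>: "0 \<le> ?\<rho> ^ n" using l by simp
    have "(?e * w (env_shift 1 \<xi>) + ?e * w (env_shift (-1) \<xi>)) / 2 + ennreal (\<xi> 0) * (?e * w \<xi>) \<le>
      (?e * ?p + ?e * ?p) / 2 + ennreal (\<xi> 0) * (?e * ?p)"
      using Suc.prems
      by (intro add_mono divide_right_mono_ennreal mult_left_mono w) (auto simp: env_shift_def)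
    also have "\<dots> = ennreal ((1 + \<xi> 0) * (exp (- s) * ?\<rho> ^ n))"
      unfolding ennreal_double_half using l \<rho> by (simp add: ennreal_mult[symmetric] ennreal_plus[symmetric] ring_distribs del: ennreal_plus)
    finally have "ennreal (exp (- (1 + \<xi> 0) * s)) *
       ((?e * w (env_shift 1 \<xi>) + ?e * w (env_shift (-1) \<xi>)) / 2 + ennreal (\<xi> 0) * (?e * w \<xi>)) *
         indicator {0<..} s \<le> ennreal (exp (- (1 + \<xi> 0) * s)) * ennreal ((1 + \<xi> 0) * (exp (- s) * ?\<rho> ^ n)) * indicator {0..} s"
      by (intro mult_mono mult_left_mono) (auto simp: indicator_def)
    also have "\<dots> = ennreal ((1 + \<xi> 0) / (2 + \<xi> 0) * ?\<rho> ^ n) *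
      (ennreal ((2 + \<xi> 0) * exp (- (2 + \<xi> 0) * s)) * indicator {0..} s)"
    proof -
      have "exp (- (1 + \<xi> 0) * s) * ((1 + \<xi> 0) * (exp (- s) * ?\<rho> ^ n)) =
         (1 + \<xi> 0) / (2 + \<xi> 0) * ?\<rho> ^ n * ((2 + \<xi> 0) * exp (- (2 + \<xi> 0) * s))"
      proof -
        have e: "exp (- (2 + \<xi> 0) * s) = exp (- (1 + \<xi> 0) * s) * exp (- s)"
          by (simp add: exp_add[symmetric] algebra_simps)
        have "x * ((1 + \<xi> 0) * (y * p)) = (1 + \<xi> 0) / (2 + \<xi> 0) * p * ((2 + \<xi> 0) * (x * y))" for x y p
          using l by simp
        then show ?thesis unfolding e .
      qed
      moreover have "0 \<le> (1 + \<xi> 0) * (exp (- s) * ?\<rho> ^ n)" "0 \<le> (1 + \<xi> 0) / (2 + \<xi> 0) * ?\<rho> ^ n"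
          "0 \<le> (2 + \<xi> 0) * exp (- (2 + \<xi> 0) * s)" "0 \<le> exp (- (1 + \<xi> 0) * s)"
        using l by auto
      ultimately show ?thesis
        unfolding mult.assoc[symmetric, of _ _ "indicator {0..} s :: ennreal"]
        by (metis (no_types, lifting) ennreal_mult)
    qed
    finally show "ennreal (exp (- (1 + \<xi> 0) * s)) *
       ((?e * w (env_shift 1 \<xi>) + ?e * w (env_shift (-1) \<xi>)) / 2 + ennreal (\<xi> 0) * (?e * w \<xi>)) *
         indicator {0<..} s \<le> ennreal ((1 + \<xi> 0) / (2 + \<xi> 0) * ?\<rho> ^ n) *
      (ennreal ((2 + \<xi> 0) * exp (- (2 + \<xi> 0) * s)) * indicator {0..} s)" .
  qed
  also have "\<dots> = ennreal ((1 + \<xi> 0) / (2 + \<xi> 0) * ?\<rho> ^ n)"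
    using nn_integral_exponential_atLeast[of "2 + \<xi> 0" 0] l by (subst nn_integral_cmult) auto
  also have "\<dots> \<le> ennreal (?\<rho> ^ Suc n)"
  proof -
    have "(1 + \<xi> 0) / (2 + \<xi> 0) \<le> ?\<rho>"
      using l by (simp add: field_simps)
    then show ?thesis
      using l by (auto intro!: ennreal_leI mult_right_mono simp del: times_divide_eq_left times_divide_eq_right)
  qed
  finally show ?case .
qed simp

lemma AE_spine_escapes:
  assumes "\<forall>x. 0 < \<xi> x" "\<forall>x. \<xi> x \<le> b"
  shows "AE c in clock_space. \<exists>n. t < start_time \<xi> c (replicate n False)"
proof -
  let ?\<rho> = "(1 + b) / (2 + b)"
  define A where "A = {c. \<forall>n. start_time \<xi> c (replicate n False) \<le> t}"
  have [measurable]: "A \<in> sets clock_space"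
  proof -
    have "{c \<in> space clock_space. \<forall>n. start_time \<xi> c (replicate n False) \<le> t} \<in> sets clock_space"
      by measurable
    then show ?thesis by (simp add: A_def)
  qed
  have b: "0 < b" using assms by (meson less_le_trans)
  have bound: "emeasure clock_space A \<le> ennreal (exp t * ?\<rho> ^ n)" for n
  proof -
    have "emeasure clock_space A = (\<integral>\<^sup>+c. indicator A c \<partial>clock_space)"
      by simp
    also have "\<dots> \<le> (\<integral>\<^sup>+c. ennreal (exp t) * ennreal (exp (- start_time \<xi> c (replicate n False))) \<partial>clock_space)"
      by (intro nn_integral_mono)
         (auto simp: A_def indicator_def ennreal_mult[symmetric] exp_add[symmetric])
    also have "\<dots> = ennreal (exp t) * (\<integral>\<^sup>+c. ennreal (exp (- start_time \<xi> c (replicate n False))) \<partial>clock_space)"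
      by (rule nn_integral_cmult) measurable
    also have "\<dots> \<le> ennreal (exp t) * ennreal (?\<rho> ^ n)"
      by (intro mult_left_mono spine_start_time_laplace assms) auto
    finally show ?thesis using b by (simp add: ennreal_mult)
  qed
  have "(\<lambda>n. ennreal (exp t * ?\<rho> ^ n)) \<longlonglongrightarrow> ennreal (exp t * 0)"
    using b by (intro tendsto_ennrealI tendsto_mult tendsto_const LIMSEQ_power_zero) auto
  then have "emeasure clock_space A \<le> 0"
    using bound by (intro LIMSEQ_le_const[where X="\<lambda>n. ennreal (exp t * ?\<rho> ^ n)"]) auto
  then have "A \<in> null_sets clock_space" by auto
  then show ?thesis
    by (rule AE_I') (auto simp: A_def not_less)
qed

lemma particles_nonempty:
  assumes "0 \<le> t" "\<exists>n. t < start_time \<xi> c (replicate n False)"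
  shows "particles \<xi> c t \<noteq> {}"
proof -
  define n where "n = (LEAST n. t < start_time \<xi> c (replicate n False))"
  have n: "t < start_time \<xi> c (replicate n False)"
    unfolding n_def using assms(2) by (rule LeastI_ex)
  with assms(1) obtain m where m: "n = Suc m" by (cases n) auto
  then have "\<not> t < start_time \<xi> c (replicate m False)"
    unfolding n_def by (metis lessI not_less_Least)
  moreover have "occurs \<xi> c (replicate k False)" for k
    by (induction k) auto
  ultimately have "replicate m False \<in> particles \<xi> c t"
    using n m by (simp add: particles_def)
  then show ?thesis by blast
qed

text \<open>
  The moment with \<open>\<theta> = 0\<close> counts the particles, so its finite mean excludes explosion.
\<close>

lemma AE_populated:
  assumes "\<forall>x. 0 < \<xi> x" "\<forall>x. \<xi> x \<le> b" "0 \<le> t"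
  shows "AE c in clock_space. populated \<xi> c t"
proof -
  have "(\<integral>\<^sup>+c. exp_moment 0 \<xi> c t \<partial>clock_space) < \<infinity>"
    using exp_moment_le[OF assms, of 0] by (rule order.strict_trans1) simp
  then have "AE c in clock_space. exp_moment 0 \<xi> c t \<noteq> \<infinity>"
    by (intro nn_integral_PInf_AE measurable_exp_moment) auto
  with AE_spine_escapes[OF assms(1,2), of t] show ?thesis
  proof eventually_elim
    case (elim c)
    then show ?case
      using particles_nonempty[OF assms(3)] by (auto simp: populated_def less_top intro!: finite_particles)
  qed
qed

lemma nn_integral_exp_rightmost_le:
  fixes \<theta> :: real
  assumes "\<forall>x. 0 < \<xi> x" "\<forall>x. \<xi> x \<le> b" "0 \<le> t"
  shows "(\<integral>\<^sup>+c. ennreal (exp (\<theta> * rightmost \<xi> c t)) \<partial>clock_space) \<le> ennreal (exp ((cosh \<theta> - 1 + b) * t))"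
proof -
  have "AE c in clock_space. ennreal (exp (\<theta> * rightmost \<xi> c t)) \<le> exp_moment \<theta> \<xi> c t"
    using AE_populated[OF assms]
  proof eventually_elim
    case (elim c)
    then have "rightmost \<xi> c t \<in> site \<xi> c ` particles \<xi> c t"
      unfolding rightmost_def populated_def by (intro Max_in) auto
    then show ?case by (auto intro: exp_site_le_exp_moment)
  qed
  then have "(\<integral>\<^sup>+c. ennreal (exp (\<theta> * rightmost \<xi> c t)) \<partial>clock_space) \<le>
      (\<integral>\<^sup>+c. exp_moment \<theta> \<xi> c t \<partial>clock_space)"
    by (rule nn_integral_mono_AE)
  with exp_moment_le[OF assms] show ?thesis by (rule order_trans[rotated])
qed

section \<open>The renewal equation for the law of the maximum\<close>

lemma nn_integral_cong_AE_AE: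
  assumes "AE x in M. AE y in N. f x y = g x y"
  shows "(\<integral>\<^sup>+x. \<integral>\<^sup>+y. f x y \<partial>N \<partial>M) = (\<integral>\<^sup>+x. \<integral>\<^sup>+y. g x y \<partial>N \<partial>M)"
  by (rule nn_integral_cong_AE) (use assms in \<open>auto elim!: eventually_mono intro: nn_integral_cong_AE\<close>)

lemma measurable_rightmost_fun2:
  assumes "f \<in> N \<rightarrow>\<^sub>M env_space" "g \<in> N \<rightarrow>\<^sub>M clock_space" "h \<in> borel_measurable N"
    and "f' \<in> N \<rightarrow>\<^sub>M env_space" "g' \<in> N \<rightarrow>\<^sub>M clock_space" "h' \<in> borel_measurable N"
  shows "(\<lambda>w. F (rightmost (f w) (g w) (h w)) (rightmost (f' w) (g' w) (h' w))) \<in> borel_measurable N"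
proof (rule measurable_compose_countable[where f="\<lambda>i w. F i (rightmost (f' w) (g' w) (h' w))"])
  show "(\<lambda>w. rightmost (f w) (g w) (h w)) \<in> N \<rightarrow>\<^sub>M count_space UNIV"
    by (rule measurable_rightmost[OF assms(1-3)])
  show "(\<lambda>w. F i (rightmost (f' w) (g' w) (h' w))) \<in> borel_measurable N" for i
    by (rule measurable_rightmost_fun[OF assms(4-6)])
qed

definition expect_max :: "(int \<Rightarrow> ennreal) \<Rightarrow> (int \<Rightarrow> real) \<Rightarrow> real \<Rightarrow> ennreal" where
  "expect_max f \<xi> t = (\<integral>\<^sup>+c. f (rightmost \<xi> c t) \<partial>clock_space)"

definition expect_max2 :: "(int \<Rightarrow> int \<Rightarrow> ennreal) \<Rightarrow> (int \<Rightarrow> real) \<Rightarrow> real \<Rightarrow> ennreal" where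
  "expect_max2 f \<xi> t =
     (\<integral>\<^sup>+c. \<integral>\<^sup>+c'. f (rightmost \<xi> c t) (rightmost \<xi> c' t) \<partial>clock_space \<partial>clock_space)"

lemma measurable_expect_max [measurable (raw)]:
  assumes [measurable]: "g \<in> N \<rightarrow>\<^sub>M env_space" "h \<in> borel_measurable N"
  shows "(\<lambda>w. expect_max f (g w) (h w)) \<in> borel_measurable N"
proof -
  have [measurable]: "(\<lambda>(w, c). f (rightmost (g w) c (h w))) \<in> borel_measurable (N \<Otimes>\<^sub>M clock_space)"
    unfolding split_beta' by (rule measurable_rightmost_fun) measurable
  show ?thesis unfolding expect_max_def by measurable
qed

lemma measurable_expect_max2 [measurable (raw)]:
  assumes [measurable]: "g \<in> N \<rightarrow>\<^sub>M env_space" "h \<in> borel_measurable N"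
  shows "(\<lambda>w. expect_max2 f (g w) (h w)) \<in> borel_measurable N"
proof -
  have [measurable]: "(\<lambda>((w, c), c'). f (rightmost (g w) c (h w)) (rightmost (g w) c' (h w)))
      \<in> borel_measurable ((N \<Otimes>\<^sub>M clock_space) \<Otimes>\<^sub>M clock_space)"
    unfolding split_beta' by (rule measurable_rightmost_fun2) measurable
  show ?thesis unfolding expect_max2_def by measurable
qed

text \<open>
  The rate at which mass flows into the law of the maximum when the first sojourn ends and a time
  \<open>s\<close> is left: jumps to the two neighbours at rate \<open>1 / 2\<close> each, and a split at rate \<open>\<xi> 0\<close>, after which
  two independent populations compete.
\<close>

definition branching_source :: "(int \<Rightarrow> ennreal) \<Rightarrow> (int \<Rightarrow> real) \<Rightarrow> real \<Rightarrow> ennreal" where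
  "branching_source f \<xi> s =
     (expect_max (\<lambda>k. f (1 + k)) (env_shift 1 \<xi>) s + expect_max (\<lambda>k. f (-1 + k)) (env_shift (-1) \<xi>) s) / 2
     + ennreal (\<xi> 0) * expect_max2 (\<lambda>k l. f (max k l)) \<xi> s"

lemma measurable_branching_source [measurable (raw)]:
  assumes [measurable]: "g \<in> N \<rightarrow>\<^sub>M env_space" "h \<in> borel_measurable N"
  shows "(\<lambda>w. branching_source f (g w) (h w)) \<in> borel_measurable N"
proof -
  have [measurable]: "(\<lambda>w. g w 0) \<in> borel_measurable N"
    using measurable_compose[OF assms(1) measurable_env_apply] .
  show ?thesis unfolding branching_source_def by measurable
qed

text \<open>
  Either the first sojourn outlasts \<open>t\<close>, and the particle is still at \<open>0\<close>, or it ends when a time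
  \<open>s\<close> is left. The integration variable is the time left, not the time elapsed, so that only the
  exponential weight depends on \<open>t\<close>; this makes the two consequences below immediate.
\<close>

theorem renewal_equation:
  assumes pos: "\<forall>x. 0 < \<xi> x" and bdd: "\<forall>x. \<xi> x \<le> b" and t: "0 \<le> t"
  shows "expect_max f \<xi> t = ennreal (exp (- (1 + \<xi> 0) * t)) * f 0 +
    (\<integral>\<^sup>+s. ennreal (exp (- (1 + \<xi> 0) * (t - s))) * branching_source f \<xi> s * indicator {0..<t} s \<partial>lborel)"
proof -
  define l where "l = 1 + \<xi> 0"
  have r: "0 < \<xi> 0" "0 < l" using pos by (auto simp: l_def add_pos_pos)
  define gJ where "gJ d s = (if t < s then f 0 else expect_max (\<lambda>k. f (d + k)) (env_shift d \<xi>) (t - s))" for d s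
  define gS where "gS s = (if t < s then f 0 else expect_max2 (\<lambda>k l. f (max k l)) \<xi> (t - s))" for s
  have shift: "\<forall>x. 0 < env_shift d \<xi> x" "\<forall>x. env_shift d \<xi> x \<le> b" for d
    using pos bdd by (auto simp: env_shift_def)
  have "expect_max f \<xi> t = (\<integral>\<^sup>+s. ennreal (exp (- (1 + \<xi> 0) * s)) *
      ((gJ 1 s + gJ (-1) s) / 2 + ennreal (\<xi> 0) * gS s) * indicator {0<..} s \<partial>lborel)"
    unfolding expect_max_def
  proof (rule first_sojourn)
    show "(\<lambda>c. f (rightmost \<xi> c t)) \<in> borel_measurable clock_space"
      by (rule measurable_rightmost_fun) measurable
    show "gJ d \<in> borel_measurable borel" for d
      unfolding gJ_def by measurable
    show "gS \<in> borel_measurable borel"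
      unfolding gS_def by measurable
    fix j s :: real and d :: int
    assume js: "0 < j" "0 < s"
    let ?g = "graft (j, s, d)"
    show "(\<integral>\<^sup>+c. \<integral>\<^sup>+c'. f (rightmost \<xi> (?g c c') t) \<partial>clock_space \<partial>clock_space) =
      (if j < s / \<xi> 0 then gJ d j else gS (s / \<xi> 0))"
    proof (cases "t < min j (s / \<xi> 0)")
      case True
      have "AE c in clock_space. AE c' in clock_space. f (rightmost \<xi> (?g c c') t) = f 0"
        using AE_positive_clocks
      proof eventually_elim
        case (elim c)
        show ?case
          using AE_positive_clocks
          by eventually_elim (use elim pos t True in \<open>simp add: rightmost_graft_before\<close>)
      qed
      then have "(\<integral>\<^sup>+c. \<integral>\<^sup>+c'. f (rightmost \<xi> (?g c c') t) \<partial>clock_space \<partial>clock_space) =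
          (\<integral>\<^sup>+c. \<integral>\<^sup>+c'. f 0 \<partial>clock_space \<partial>clock_space)"
        by (rule nn_integral_cong_AE_AE)
      with True show ?thesis by (auto simp: gJ_def gS_def)
    next
      case False
      show ?thesis
      proof (cases "j < s / \<xi> 0")
        case True
        with False have jt: "j \<le> t" by auto
        then have pop: "AE c in clock_space. populated (env_shift d \<xi>) c (t - j)"
          using shift by (intro AE_populated) auto
        have "(\<integral>\<^sup>+c. \<integral>\<^sup>+c'. f (rightmost \<xi> (?g c c') t) \<partial>clock_space \<partial>clock_space) =
          (\<integral>\<^sup>+c. \<integral>\<^sup>+c'. f (d + rightmost (env_shift d \<xi>) c (t - j)) \<partial>clock_space \<partial>clock_space)"
          using pop True jt
          by (intro nn_integral_cong_AE) (auto simp: rightmost_graft_jump elim!: eventually_mono)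
        with True jt show ?thesis by (simp add: gJ_def expect_max_def)
      next
        case split: False
        with False have st: "s / \<xi> 0 \<le> t" by auto
        then have pop: "AE c in clock_space. populated \<xi> c (t - s / \<xi> 0)"
          using pos bdd by (intro AE_populated) auto
        have "AE c in clock_space. AE c' in clock_space. f (rightmost \<xi> (?g c c') t) =
            f (max (rightmost \<xi> c (t - s / \<xi> 0)) (rightmost \<xi> c' (t - s / \<xi> 0)))"
          using pop
        proof eventually_elim
          case (elim c)
          show ?case
            using pop by eventually_elim (use elim split st in \<open>simp add: rightmost_graft_split\<close>)
        qed
        then have "(\<integral>\<^sup>+c. \<integral>\<^sup>+c'. f (rightmost \<xi> (?g c c') t) \<partial>clock_space \<partial>clock_space) =
            (\<integral>\<^sup>+c. \<integral>\<^sup>+c'. f (max (rightmost \<xi> c (t - s / \<xi> 0)) (rightmost \<xi> c' (t - s / \<xi> 0)))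
               \<partial>clock_space \<partial>clock_space)"
          by (rule nn_integral_cong_AE_AE)
        with split st show ?thesis by (auto simp: gS_def expect_max2_def)
      qed
    qed
  qed (use r in auto)
  also have "\<dots> = (\<integral>\<^sup>+s. f 0 * (ennreal (l * exp (- l * s)) * indicator {t<..} s) +
      ennreal (exp (- l * s)) * branching_source f \<xi> (t - s) * indicator {0<..t} s \<partial>lborel)"
  proof (rule nn_integral_cong)
    fix s :: real
    show "ennreal (exp (- (1 + \<xi> 0) * s)) * ((gJ 1 s + gJ (-1) s) / 2 + ennreal (\<xi> 0) * gS s) * indicator {0<..} s
      = f 0 * (ennreal (l * exp (- l * s)) * indicator {t<..} s) +
      ennreal (exp (- l * s)) * branching_source f \<xi> (t - s) * indicator {0<..t} s"
    proof (cases "t < s")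
      case True
      have "f 0 + ennreal (\<xi> 0) * f 0 = f 0 * ennreal l"
        using r by (simp add: l_def ring_distribs mult.commute)
      with True t r show ?thesis
        by (simp add: gJ_def gS_def l_def[symmetric] ennreal_mult mult_ac)
    next
      case False
      with r show ?thesis
        by (auto simp: gJ_def gS_def branching_source_def l_def indicator_def)
    qed
  qed
  also have "\<dots> = (\<integral>\<^sup>+s. f 0 * (ennreal (l * exp (- l * s)) * indicator {t<..} s) \<partial>lborel) +
      (\<integral>\<^sup>+s. ennreal (exp (- l * s)) * branching_source f \<xi> (t - s) * indicator {0<..t} s \<partial>lborel)"
    by (rule nn_integral_add) measurable
  also have "(\<integral>\<^sup>+s. f 0 * (ennreal (l * exp (- l * s)) * indicator {t<..} s) \<partial>lborel) =
      f 0 * ennreal (exp (- l * t))"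
    using nn_integral_exponential_greaterThan[OF r(2)] by (subst nn_integral_cmult) auto
  also have "(\<integral>\<^sup>+s. ennreal (exp (- l * s)) * branching_source f \<xi> (t - s) * indicator {0<..t} s \<partial>lborel) =
      (\<integral>\<^sup>+s. ennreal (exp (- l * (t - s))) * branching_source f \<xi> s * indicator {0..<t} s \<partial>lborel)"
    by (subst nn_integral_real_affine[where c="-1" and t=t], measurable)
       (auto simp: indicator_def intro!: nn_integral_cong)
  finally show ?thesis by (simp add: l_def mult.commute)
qed

text \<open>
  If the first sojourn outlasts \<open>h\<close>, the population at time \<open>t + h\<close> is a delayed copy of the
  population at time \<open>t\<close>. In the renewal equation this is seen by restricting the integral
  to \<open>s < t\<close>.
\<close>

corollary expect_max_persists:
  assumes "\<forall>x. 0 < \<xi> x" "\<forall>x. \<xi> x \<le> b" "0 \<le> t" "0 \<le> h"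
  shows "ennreal (exp (- (1 + \<xi> 0) * h)) * expect_max f \<xi> t \<le> expect_max f \<xi> (t + h)"
proof -
  let ?l = "1 + \<xi> 0"
  have e: "ennreal (exp (- ?l * h)) * ennreal (exp (- ?l * s)) = ennreal (exp (- ?l * (s + h)))" for s
    by (simp add: ennreal_mult[symmetric] exp_add[symmetric] algebra_simps)
  have "ennreal (exp (- ?l * h)) * expect_max f \<xi> t =
    ennreal (exp (- ?l * h)) * ennreal (exp (- ?l * t)) * f 0 +
    (\<integral>\<^sup>+s. ennreal (exp (- ?l * h)) *
      (ennreal (exp (- ?l * (t - s))) * branching_source f \<xi> s * indicator {0..<t} s) \<partial>lborel)"
    unfolding renewal_equation[OF assms(1-3)]
    by (subst nn_integral_cmult) (simp_all only: distrib_left mult.assoc, measurable)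
  also have "\<dots> \<le> ennreal (exp (- ?l * (t + h))) * f 0 +
    (\<integral>\<^sup>+s. ennreal (exp (- ?l * (t + h - s))) * branching_source f \<xi> s * indicator {0..<t + h} s \<partial>lborel)"
  proof (intro add_mono nn_integral_mono)
    fix s :: real
    have "ennreal (exp (- ?l * h)) * ennreal (exp (- ?l * (t - s))) = ennreal (exp (- ?l * (t + h - s)))"
      unfolding e by (simp add: algebra_simps)
    then show "ennreal (exp (- ?l * h)) *
        (ennreal (exp (- ?l * (t - s))) * branching_source f \<xi> s * indicator {0..<t} s) \<le>
      ennreal (exp (- ?l * (t + h - s))) * branching_source f \<xi> s * indicator {0..<t + h} s"
      unfolding mult.assoc[symmetric] using assms(4) by (auto simp: indicator_def)
  qed (simp only: e order_refl)
  also have "\<dots> = expect_max f \<xi> (t + h)"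
    using assms(3,4) by (subst renewal_equation[OF assms(1,2)]) auto
  finally show ?thesis .
qed

text \<open>
  The conclusion is \<open>y' = K - l * y\<close> in integrated form, written without subtraction. Passing from the
  exponential weight to the term \<open>l * y\<close> matters because in the application \<open>l = 1 + \<xi> 0\<close> is random: a
  weight \<open>exp (- l * s)\<close> would be correlated with \<open>K\<close> and prevent averaging over the environment,
  whereas the terms below can be averaged one by one. Tonelli's theorem gives the identity
  for arbitrary measurable \<open>K\<close>, with no continuity.
\<close>

lemma killed_equation_integrated:
  fixes y K :: "real \<Rightarrow> ennreal"
  assumes [measurable]: "K \<in> borel_measurable borel" and l: "0 < l" and t: "0 \<le> t"
    and y: "\<And>s. 0 \<le> s \<Longrightarrow> y s = ennreal (exp (- l * s)) * y0 +
      (\<integral>\<^sup>+r. ennreal (exp (- l * (s - r))) * K r * indicator {0..<s} r \<partial>lborel)"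
  shows "y t + ennreal l * (\<integral>\<^sup>+s. y s * indicator {0..<t} s \<partial>lborel) =
    y0 + (\<integral>\<^sup>+r. K r * indicator {0..<t} r \<partial>lborel)"
proof -
  have E: "(\<integral>\<^sup>+s. ennreal (l * exp (- l * (s - r))) * indicator {r<..<t} s \<partial>lborel) = ennreal (1 - exp (- l * (t - r)))"
    if "r \<le> t" for r
  proof -
    have "AE s in lborel. s \<noteq> r" "AE s in lborel. s \<noteq> t"
      by (rule AE_lborel_singleton)+
    then have "AE s in lborel. ennreal (l * exp (- l * (s - r))) * indicator {r<..<t} s =
        ennreal (l * exp (- l * (s - r))) * indicator {r..t} s"
      by eventually_elim (auto simp: indicator_def)
    then have "(\<integral>\<^sup>+s. ennreal (l * exp (- l * (s - r))) * indicator {r<..<t} s \<partial>lborel) =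
        (\<integral>\<^sup>+s. ennreal (l * exp (- l * (s - r))) * indicator {r..t} s \<partial>lborel)"
      by (rule nn_integral_cong_AE)
    also have "\<dots> = ennreal ((- exp (- l * (t - r))) - (- exp (- l * (r - r))))"
      using l that by (intro nn_integral_FTC_Icc) (auto intro!: derivative_eq_intros)
    finally show ?thesis by simp
  qed
  have "ennreal l * (\<integral>\<^sup>+s. y s * indicator {0..<t} s \<partial>lborel) =
    ennreal l * (\<integral>\<^sup>+s. y0 * (ennreal (exp (- l * s)) * indicator {0..<t} s) +
      (\<integral>\<^sup>+r. ennreal (exp (- l * (s - r))) * K r * (if 0 \<le> r \<and> r < s \<and> s < t then 1 else 0) \<partial>lborel) \<partial>lborel)"
  proof (intro arg_cong2[where f="(*)"] refl nn_integral_cong)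
    fix s :: real
    show "y s * indicator {0..<t} s = y0 * (ennreal (exp (- l * s)) * indicator {0..<t} s) +
      (\<integral>\<^sup>+r. ennreal (exp (- l * (s - r))) * K r * (if 0 \<le> r \<and> r < s \<and> s < t then 1 else 0) \<partial>lborel)"
    proof (cases "s \<in> {0..<t}")
      case True
      then show ?thesis
        by (auto simp: y indicator_def mult.commute intro!: nn_integral_cong arg_cong2[where f="(+)"])
    next
      case False
      then have "(if 0 \<le> r \<and> r < s \<and> s < t then 1 else 0) = (0 :: ennreal)" for r
        by auto
      with False show ?thesis by simp
    qed
  qed
  also have "\<dots> = ennreal l * (y0 * (\<integral>\<^sup>+s. ennreal (exp (- l * s)) * indicator {0..<t} s \<partial>lborel) +
      (\<integral>\<^sup>+s. \<integral>\<^sup>+r. ennreal (exp (- l * (s - r))) * K r * (if 0 \<le> r \<and> r < s \<and> s < t then 1 else 0) \<partial>lborel \<partial>lborel))"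
    by (subst nn_integral_add; (subst nn_integral_cmult)?; measurable)
  also have "(\<integral>\<^sup>+s. \<integral>\<^sup>+r. ennreal (exp (- l * (s - r))) * K r * (if 0 \<le> r \<and> r < s \<and> s < t then 1 else 0) \<partial>lborel \<partial>lborel) =
     (\<integral>\<^sup>+r. \<integral>\<^sup>+s. ennreal (exp (- l * (s - r))) * K r * (if 0 \<le> r \<and> r < s \<and> s < t then 1 else 0) \<partial>lborel \<partial>lborel)"
    by (rule lborel_pair.Fubini') measurable
  also have "ennreal l * (y0 * (\<integral>\<^sup>+s. ennreal (exp (- l * s)) * indicator {0..<t} s \<partial>lborel) + \<dots>) =
     y0 * (\<integral>\<^sup>+s. ennreal (l * exp (- l * (s - 0))) * indicator {0<..<t} s \<partial>lborel) +
     (\<integral>\<^sup>+r. K r * indicator {0..<t} r * (\<integral>\<^sup>+s. ennreal (l * exp (- l * (s - r))) * indicator {r<..<t} s \<partial>lborel) \<partial>lborel)"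
  proof -
    have le: "ennreal l * ennreal (exp x) = ennreal (l * exp x)" for x
      using l by (simp add: ennreal_mult)
    have "AE s in lborel. s \<noteq> (0::real)"
      by (rule AE_lborel_singleton)
    then have "(\<integral>\<^sup>+s. ennreal l * (ennreal (exp (- l * s)) * indicator {0..<t} s) \<partial>lborel) =
        (\<integral>\<^sup>+s. ennreal (l * exp (- l * (s - 0))) * indicator {0<..<t} s \<partial>lborel)"
      by (intro nn_integral_cong_AE)
         (auto simp: indicator_def le mult.assoc[symmetric] simp del: mult_minus_left elim!: eventually_mono)
    then have A: "ennreal l * (\<integral>\<^sup>+s. ennreal (exp (- l * s)) * indicator {0..<t} s \<partial>lborel) =
        (\<integral>\<^sup>+s. ennreal (l * exp (- l * (s - 0))) * indicator {0<..<t} s \<partial>lborel)"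
      by (subst nn_integral_cmult[symmetric]) auto
    have B: "ennreal l * (\<integral>\<^sup>+s. ennreal (exp (- l * (s - r))) * K r * (if 0 \<le> r \<and> r < s \<and> s < t then 1 else 0) \<partial>lborel) =
        K r * indicator {0..<t} r * (\<integral>\<^sup>+s. ennreal (l * exp (- l * (s - r))) * indicator {r<..<t} s \<partial>lborel)" for r
      by (subst (1 2) nn_integral_cmult[symmetric]; (intro nn_integral_cong)?)
         (auto simp: indicator_def le[symmetric] mult_ac simp del: mult_minus_left)
    let ?F = "\<lambda>r. \<integral>\<^sup>+s. ennreal (exp (- l * (s - r))) * K r * (if 0 \<le> r \<and> r < s \<and> s < t then 1 else 0) \<partial>lborel"
    have "ennreal l * (\<integral>\<^sup>+r. ?F r \<partial>lborel) = (\<integral>\<^sup>+r. ennreal l * ?F r \<partial>lborel)"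
      by (rule nn_integral_cmult[symmetric]) measurable
    then show ?thesis
      unfolding distrib_left mult.left_commute[of "ennreal l" y0] A B by simp
  qed
  also have "\<dots> = y0 * ennreal (1 - exp (- l * t)) +
     (\<integral>\<^sup>+r. ennreal (1 - exp (- l * (t - r))) * K r * indicator {0..<t} r \<partial>lborel)"
  proof (intro arg_cong2[where f="(+)"] nn_integral_cong)
    show "y0 * (\<integral>\<^sup>+s. ennreal (l * exp (- l * (s - 0))) * indicator {0<..<t} s \<partial>lborel) = y0 * ennreal (1 - exp (- l * t))"
      unfolding E[OF t] by simp
    fix r
    show "K r * indicator {0..<t} r * (\<integral>\<^sup>+s. ennreal (l * exp (- l * (s - r))) * indicator {r<..<t} s \<partial>lborel) =
       ennreal (1 - exp (- l * (t - r))) * K r * indicator {0..<t} r"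
    proof (cases "r \<in> {0..<t}")
      case True
      then have "r \<le> t" by simp
      then show ?thesis unfolding E[OF \<open>r \<le> t\<close>] by (simp only: mult_ac)
    qed simp
  qed
  finally have "y t + ennreal l * (\<integral>\<^sup>+s. y s * indicator {0..<t} s \<partial>lborel) =
     y0 * (ennreal (exp (- l * t)) + ennreal (1 - exp (- l * t))) +
     ((\<integral>\<^sup>+r. ennreal (exp (- l * (t - r))) * K r * indicator {0..<t} r \<partial>lborel) +
     (\<integral>\<^sup>+r. ennreal (1 - exp (- l * (t - r))) * K r * indicator {0..<t} r \<partial>lborel))"
    by (simp add: y[OF t] ring_distribs mult_ac add_ac)
  also have "\<dots> = y0 + (\<integral>\<^sup>+r. K r * indicator {0..<t} r \<partial>lborel)"
  proof (intro arg_cong2[where f="(+)"])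
    have one: "ennreal (exp (- l * s)) + ennreal (1 - exp (- l * s)) = 1" if "0 \<le> s" for s
      using that l by (subst ennreal_plus[symmetric]) auto
    show "y0 * (ennreal (exp (- l * t)) + ennreal (1 - exp (- l * t))) = y0"
      using one[OF t] by simp
    show "(\<integral>\<^sup>+r. ennreal (exp (- l * (t - r))) * K r * indicator {0..<t} r \<partial>lborel) +
     (\<integral>\<^sup>+r. ennreal (1 - exp (- l * (t - r))) * K r * indicator {0..<t} r \<partial>lborel) =
      (\<integral>\<^sup>+r. K r * indicator {0..<t} r \<partial>lborel)"
      using one
      by (subst nn_integral_add[symmetric]; (intro nn_integral_cong)?)
         (auto simp: indicator_def ring_distribs[symmetric] simp del: mult_minus_left)
  qed
  finally show ?thesis .
qed

corollary integrated_renewal_equation: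
  assumes "\<forall>x. 0 < \<xi> x" "\<forall>x. \<xi> x \<le> b" "0 \<le> t"
  shows "expect_max f \<xi> t + ennreal (1 + \<xi> 0) * (\<integral>\<^sup>+s. expect_max f \<xi> s * indicator {0..<t} s \<partial>lborel) =
    f 0 + (\<integral>\<^sup>+s. branching_source f \<xi> s * indicator {0..<t} s \<partial>lborel)"
proof (rule killed_equation_integrated)
  show "0 < 1 + \<xi> 0" using assms(1) by (simp add: add_pos_pos)
  show "branching_source f \<xi> \<in> borel_measurable borel" by measurable
  show "expect_max f \<xi> s = ennreal (exp (- (1 + \<xi> 0) * s)) * f 0 +
      (\<integral>\<^sup>+r. ennreal (exp (- (1 + \<xi> 0) * (s - r))) * branching_source f \<xi> r * indicator {0..<s} r \<partial>lborel)"
    if "0 \<le> s" for s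
    by (rule renewal_equation[OF assms(1,2) that])
qed (rule assms)

section \<open>The gap between two independent populations\<close>

definition pos_part :: "int \<Rightarrow> ennreal" where "pos_part k = ennreal (real_of_int k)"

text \<open>
  Identities between positive parts of integers become identities between natural numbers, which
  linear arithmetic decides.
\<close>

lemma pos_part_nat: "pos_part k = of_nat (nat k)"
  by (cases "0 \<le> k") (auto simp: pos_part_def ennreal_of_nat_eq_real_of_nat ennreal_neg)

text \<open>
  By symmetry of the two populations this is half the mean of \<open>|M - M'|\<close>.
\<close>

definition gap :: "(int \<Rightarrow> real) \<Rightarrow> real \<Rightarrow> ennreal" where
  "gap = expect_max2 (\<lambda>k l. pos_part (l - k))"

lemma measurable_rightmost_const [measurable]:
  "(\<lambda>c. F (rightmost \<xi> c t)) \<in> borel_measurable clock_space"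
  by (rule measurable_rightmost_fun) measurable

lemma measurable_rightmost_pair [measurable]:
  "(\<lambda>(c, c'). F (rightmost \<xi> c t) (rightmost \<xi> c' t)) \<in> borel_measurable (clock_space \<Otimes>\<^sub>M clock_space)"
  unfolding split_beta' by (rule measurable_rightmost_fun2) measurable

lemma expect_max2_eq:
  "expect_max2 f \<xi> t = expect_max (\<lambda>k. expect_max (f k) \<xi> t) \<xi> t"
  by (simp add: expect_max2_def expect_max_def)

text \<open>
  Apply \<open>expect_max_persists\<close> to one population and then to the other; each delay costs a factor
  \<open>exp (- (1 + \<xi> 0) * h)\<close>.
\<close>

lemma gap_persists:
  assumes "\<forall>x. 0 < \<xi> x" "\<forall>x. \<xi> x \<le> b" "0 \<le> t" "0 \<le> h"
  shows "ennreal (exp (- 2 * (1 + b) * h)) * gap \<xi> t \<le> gap \<xi> (t + h)"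
proof -
  let ?e = "ennreal (exp (- (1 + \<xi> 0) * h))" and ?f = "\<lambda>k l. pos_part (l - k)"
  have mono: "expect_max F \<xi> s \<le> expect_max G \<xi> s" if "\<And>k. F k \<le> G k" for F G s
    unfolding expect_max_def using that by (intro nn_integral_mono) auto
  have cmult: "expect_max (\<lambda>k. x * F k) \<xi> s = x * expect_max F \<xi> s" for x F s
    unfolding expect_max_def by (rule nn_integral_cmult) measurable
  have "- 2 * (1 + b) * h \<le> - (1 + \<xi> 0) * h + - (1 + \<xi> 0) * h"
  proof -
    have "(1 + \<xi> 0) * h \<le> (1 + b) * h" using assms by (intro mult_right_mono) auto
    then show ?thesis by (simp add: algebra_simps)
  qed
  then have "ennreal (exp (- 2 * (1 + b) * h)) \<le> ennreal (exp (- (1 + \<xi> 0) * h + - (1 + \<xi> 0) * h))"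
    by (intro ennreal_leI) simp
  also have "\<dots> = ?e * ?e"
    unfolding exp_add by (rule ennreal_mult) auto
  finally have "ennreal (exp (- 2 * (1 + b) * h)) * gap \<xi> t \<le> (?e * ?e) * gap \<xi> t"
    by (rule mult_right_mono) simp
  also have "\<dots> = ?e * (?e * expect_max (\<lambda>k. expect_max (?f k) \<xi> t) \<xi> t)"
    by (simp add: gap_def expect_max2_eq mult.assoc)
  also have "\<dots> \<le> ?e * expect_max (\<lambda>k. expect_max (?f k) \<xi> t) \<xi> (t + h)"
    by (intro mult_left_mono expect_max_persists[OF assms]) auto
  also have "\<dots> = expect_max (\<lambda>k. ?e * expect_max (?f k) \<xi> t) \<xi> (t + h)"
    by (simp add: cmult)
  also have "\<dots> \<le> expect_max (\<lambda>k. expect_max (?f k) \<xi> (t + h)) \<xi> (t + h)"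
    by (intro mono expect_max_persists[OF assms])
  finally show ?thesis by (simp add: gap_def expect_max2_eq)
qed

text \<open>
  This is \<open>branching_source\<close> with the environment recentred at the place where the first particle
  jumped to. In a stationary environment both have the same mean.
\<close>

definition shifted_source :: "(int \<Rightarrow> ennreal) \<Rightarrow> (int \<Rightarrow> real) \<Rightarrow> real \<Rightarrow> ennreal" where
  "shifted_source f \<xi> s =
     (expect_max (\<lambda>k. f (1 + k)) \<xi> s + expect_max (\<lambda>k. f (-1 + k)) \<xi> s) / 2
     + ennreal (\<xi> 0) * expect_max2 (\<lambda>k l. f (max k l)) \<xi> s"

lemma measurable_shifted_source [measurable (raw)]:
  assumes [measurable]: "g \<in> N \<rightarrow>\<^sub>M env_space" "h \<in> borel_measurable N"
  shows "(\<lambda>w. shifted_source f (g w) (h w)) \<in> borel_measurable N"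
proof -
  have [measurable]: "(\<lambda>w. g w 0) \<in> borel_measurable N"
    using measurable_compose[OF assms(1) measurable_env_apply] .
  show ?thesis unfolding shifted_source_def by measurable
qed

text \<open>
  With positive parts moved to one side and negative parts to the other, this states that the source
  for the identity function exceeds \<open>(1 + \<xi> 0) * E M\<close> by \<open>\<xi> 0 * gap \<xi> s\<close>. The jumps contribute nothing
  because \<open>1\<close> and \<open>- 1\<close> average to \<open>0\<close>, and a split contributes the gap because
  \<open>max k l = k + (l - k)\<^sup>+\<close>.
\<close>

lemma source_balance:
  "shifted_source pos_part \<xi> s + ennreal (1 + \<xi> 0) * expect_max (\<lambda>k. pos_part (- k)) \<xi> s =
   shifted_source (\<lambda>k. pos_part (- k)) \<xi> s + ennreal (1 + \<xi> 0) * expect_max pos_part \<xi> s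
     + ennreal (\<xi> 0) * gap \<xi> s" if "0 < \<xi> 0"
proof -
  let ?q = "\<lambda>k. pos_part (- k)" and ?U = "\<lambda>f. expect_max f \<xi> s" and ?V = "\<lambda>f. expect_max2 f \<xi> s"
  have add: "?U (\<lambda>k. F k + G k) = ?U F + ?U G" for F G
    unfolding expect_max_def by (rule nn_integral_add) measurable
  have add2: "?V (\<lambda>k l. F k l + G k l) = ?V F + ?V G" for F G
    unfolding expect_max2_def
    by (subst nn_integral_add[symmetric], measurable)
       (intro nn_integral_cong nn_integral_add, measurable)
  have half: "x / 2 + x / 2 = x" for x :: ennreal
    by (simp add: add_divide_distrib_ennreal[symmetric])
  have "pos_part (1 + k) + pos_part (-1 + k) + (?q k + ?q k) =
      ?q (1 + k) + ?q (-1 + k) + (pos_part k + pos_part k)" for k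
    by (auto simp: pos_part_nat of_nat_add[symmetric] simp del: of_nat_add)
  then have "?U (\<lambda>k. pos_part (1 + k) + pos_part (-1 + k) + (?q k + ?q k)) =
      ?U (\<lambda>k. ?q (1 + k) + ?q (-1 + k) + (pos_part k + pos_part k))"
    by presburger
  then have "(?U (\<lambda>k. pos_part (1 + k)) + ?U (\<lambda>k. pos_part (-1 + k)) + (?U ?q + ?U ?q)) / 2 =
      (?U (\<lambda>k. ?q (1 + k)) + ?U (\<lambda>k. ?q (-1 + k)) + (?U pos_part + ?U pos_part)) / 2"
    unfolding add by simp
  then have 1: "(?U (\<lambda>k. pos_part (1 + k)) + ?U (\<lambda>k. pos_part (-1 + k))) / 2 + ?U ?q =
      (?U (\<lambda>k. ?q (1 + k)) + ?U (\<lambda>k. ?q (-1 + k))) / 2 + ?U pos_part"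
    by (simp add: add_divide_distrib_ennreal half)
  have "pos_part (max k l) + ?q k = ?q (max k l) + pos_part k + pos_part (l - k)" for k l
    by (auto simp: pos_part_nat of_nat_add[symmetric] max_def simp del: of_nat_add)
  then have "?V (\<lambda>k l. pos_part (max k l) + ?q k) = ?V (\<lambda>k l. ?q (max k l) + pos_part k + pos_part (l - k))"
    by presburger
  moreover have "?V (\<lambda>k l. F k) = ?U F" for F
    by (simp add: expect_max2_def expect_max_def)
  ultimately have 2: "?V (\<lambda>k l. pos_part (max k l)) + ?U ?q = ?V (\<lambda>k l. ?q (max k l)) + ?U pos_part + gap \<xi> s"
    unfolding add2 gap_def by simp
  have "ennreal (1 + \<xi> 0) * x = x + ennreal (\<xi> 0) * x" for x
    using that by (simp add: distrib_right)
  then have "shifted_source pos_part \<xi> s + ennreal (1 + \<xi> 0) * ?U ?q =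
     ((?U (\<lambda>k. pos_part (1 + k)) + ?U (\<lambda>k. pos_part (-1 + k))) / 2 + ?U ?q) +
     ennreal (\<xi> 0) * (?V (\<lambda>k l. pos_part (max k l)) + ?U ?q)"
    unfolding shifted_source_def distrib_left by (simp only: add_ac)
  also have "\<dots> = shifted_source ?q \<xi> s + ennreal (1 + \<xi> 0) * ?U pos_part + ennreal (\<xi> 0) * gap \<xi> s"
    unfolding 1 2 shifted_source_def distrib_left
    using \<open>\<And>x. ennreal (1 + \<xi> 0) * x = x + ennreal (\<xi> 0) * x\<close> by (simp only: add_ac)
  finally show ?thesis .
qed

lemma expect_max_parts_le:
  assumes "\<forall>x. 0 < \<xi> x" "\<forall>x. \<xi> x \<le> b" "0 \<le> t"
  shows "expect_max pos_part \<xi> t \<le> ennreal (exp ((cosh 1 - 1 + b) * t))"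
    and "expect_max (\<lambda>k. pos_part (- k)) \<xi> t \<le> ennreal (exp ((cosh 1 - 1 + b) * t))"
proof -
  have "x \<le> exp x" for x :: real
    using exp_ge_add_one_self[of x] by linarith
  from this[of "real_of_int k" for k] this[of "- real_of_int k" for k]
  have le: "pos_part k \<le> ennreal (exp (1 * real_of_int k))" "pos_part (- k) \<le> ennreal (exp (- 1 * real_of_int k))" for k
    unfolding pos_part_def by (auto intro!: ennreal_leI)
  show "expect_max pos_part \<xi> t \<le> ennreal (exp ((cosh 1 - 1 + b) * t))"
    using nn_integral_exp_rightmost_le[OF assms, of 1] unfolding expect_max_def
    by (rule order_trans[rotated]) (intro nn_integral_mono le)
  show "expect_max (\<lambda>k. pos_part (- k)) \<xi> t \<le> ennreal (exp ((cosh 1 - 1 + b) * t))"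
    using nn_integral_exp_rightmost_le[OF assms, of "-1"] unfolding expect_max_def cosh_minus
    by (rule order_trans[rotated]) (intro nn_integral_mono le)
qed

text \<open>
  Jensen's inequality \<open>E M \<le> ln (E (exp M)) \<le> c * t\<close> in the form of the tangent
  \<open>1 + (M - c * t) \<le> exp (M - c * t)\<close>, with the negative part of \<open>M\<close> on the other side.
\<close>

lemma expect_max_linear:
  assumes "\<forall>x. 0 < \<xi> x" "\<forall>x. \<xi> x \<le> b" "0 \<le> t"
  shows "expect_max pos_part \<xi> t \<le> expect_max (\<lambda>k. pos_part (- k)) \<xi> t + ennreal ((cosh 1 - 1 + b) * t)"
proof -
  let ?c = "cosh 1 - 1 + b"
  have c: "0 \<le> ?c"
    using cosh_real_ge_1[of 1] assms(1,2)[rule_format, of 0] by simp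
  then have ct: "0 \<le> ?c * t" using assms(3) by simp
  have "pos_part k + 1 \<le> pos_part (- k) + ennreal (?c * t) + ennreal (exp (- (?c * t))) * ennreal (exp (1 * real_of_int k))" for k
  proof -
    have "1 + (real_of_int k - ?c * t) \<le> exp (- (?c * t)) * exp (1 * real_of_int k)"
      using exp_ge_add_one_self[of "real_of_int k - ?c * t"] by (simp add: exp_add[symmetric] algebra_simps)
    then have "max 0 (real_of_int k) + 1 \<le> max 0 (- real_of_int k) + ?c * t + exp (- (?c * t)) * exp (1 * real_of_int k)"
      using ct by (smt (verit, best))
    then have "ennreal (max 0 (real_of_int k) + 1) \<le> ennreal (max 0 (- real_of_int k) + ?c * t + exp (- (?c * t)) * exp (1 * real_of_int k))"
      by (rule ennreal_leI)
    then show ?thesis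
      using ct by (simp add: pos_part_def ennreal_mult ennreal_max_0' max_def ennreal_neg split: if_splits)
  qed
  then have "(\<integral>\<^sup>+c. pos_part (rightmost \<xi> c t) + 1 \<partial>clock_space) \<le>
      (\<integral>\<^sup>+c. pos_part (- rightmost \<xi> c t) + ennreal (?c * t) +
         ennreal (exp (- (?c * t))) * ennreal (exp (1 * real_of_int (rightmost \<xi> c t))) \<partial>clock_space)"
    by (intro nn_integral_mono) blast
  also have "(\<integral>\<^sup>+c. pos_part (rightmost \<xi> c t) + 1 \<partial>clock_space) = expect_max pos_part \<xi> t + 1"
    unfolding expect_max_def by (subst nn_integral_add) auto
  also have "(\<integral>\<^sup>+c. pos_part (- rightmost \<xi> c t) + ennreal (?c * t) +
         ennreal (exp (- (?c * t))) * ennreal (exp (1 * real_of_int (rightmost \<xi> c t))) \<partial>clock_space) =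
      expect_max (\<lambda>k. pos_part (- k)) \<xi> t + ennreal (?c * t) +
      ennreal (exp (- (?c * t))) * (\<integral>\<^sup>+c. ennreal (exp (1 * real_of_int (rightmost \<xi> c t))) \<partial>clock_space)"
    unfolding expect_max_def by (simp add: nn_integral_add nn_integral_cmult)
  also have "\<dots> \<le> expect_max (\<lambda>k. pos_part (- k)) \<xi> t + ennreal (?c * t) + ennreal (exp (- (?c * t))) * ennreal (exp (?c * t))"
    by (intro add_left_mono mult_left_mono nn_integral_exp_rightmost_le assms) auto
  also have "ennreal (exp (- (?c * t))) * ennreal (exp (?c * t)) = 1"
    by (simp add: ennreal_mult[symmetric] exp_add[symmetric])
  finally show ?thesis
    by (simp add: add.commute[of _ 1] ennreal_add_left_cancel_le)
qed

section \<open>The mean gap in a stationary environment\<close>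

locale stationary_environment = prob_space R
  for R :: "(int \<Rightarrow> real) measure" +
  fixes a b :: real
  assumes sets_R [measurable_cong]: "sets R = sets env_space"
    and shift_invariant: "distr R env_space (env_shift d) = R"
    and a_pos: "0 < a"
    and elliptic: "AE \<xi> in R. \<forall>x. a \<le> \<xi> x \<and> \<xi> x \<le> b"
begin

text \<open>
  The exponent of \<open>nn_integral_exp_rightmost_le\<close> for \<open>\<theta> = 1\<close>.
\<close>

definition growth_rate :: real where "growth_rate = cosh 1 - 1 + b"

definition mean_gap :: "real \<Rightarrow> ennreal" where
  "mean_gap t = (\<integral>\<^sup>+\<xi>. gap \<xi> t \<partial>R)"

lemma AE_rates: "AE \<xi> in R. (\<forall>x. 0 < \<xi> x) \<and> (\<forall>x. \<xi> x \<le> b)"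
  using elliptic by eventually_elim (use a_pos in \<open>auto intro: less_le_trans\<close>)

lemma b_pos: "0 < b"
proof -
  have "AE \<xi> in R. 0 < b"
    using AE_rates by eventually_elim (blast intro: less_le_trans)
  then show ?thesis by simp
qed

lemma nn_integral_mono_elliptic:
  assumes "\<And>\<xi>. \<forall>x. 0 < \<xi> x \<Longrightarrow> \<forall>x. \<xi> x \<le> b \<Longrightarrow> a \<le> \<xi> 0 \<Longrightarrow> F \<xi> \<le> G \<xi>"
  shows "(\<integral>\<^sup>+\<xi>. F \<xi> \<partial>R) \<le> (\<integral>\<^sup>+\<xi>. G \<xi> \<partial>R)"
proof (rule nn_integral_mono_AE)
  show "AE \<xi> in R. F \<xi> \<le> G \<xi>"
    using AE_rates elliptic by eventually_elim (auto intro: assms)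
qed

lemma nn_integral_cong_elliptic:
  assumes "\<And>\<xi>. \<forall>x. 0 < \<xi> x \<Longrightarrow> \<forall>x. \<xi> x \<le> b \<Longrightarrow> F \<xi> = G \<xi>"
  shows "(\<integral>\<^sup>+\<xi>. F \<xi> \<partial>R) = (\<integral>\<^sup>+\<xi>. G \<xi> \<partial>R)"
  by (intro antisym nn_integral_mono_elliptic) (simp_all add: assms)

lemma growth_rate_pos: "0 < growth_rate"
  using b_pos cosh_real_ge_1[of 1] by (simp add: growth_rate_def)

lemma nn_integral_env_shift:
  assumes "F \<in> borel_measurable env_space"
  shows "(\<integral>\<^sup>+\<xi>. F (env_shift d \<xi>) \<partial>R) = (\<integral>\<^sup>+\<xi>. F \<xi> \<partial>R)"
proof -
  have [measurable]: "F \<in> borel_measurable R"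
    using assms by (simp add: measurable_cong_sets[OF sets_R refl])
  have "env_shift d \<in> R \<rightarrow>\<^sub>M env_space"
    using measurable_env_shift[of "\<lambda>x. x" R d] by (simp add: measurable_ident_sets[OF sets_R])
  then have "(\<integral>\<^sup>+\<xi>. F \<xi> \<partial>distr R env_space (env_shift d)) = (\<integral>\<^sup>+\<xi>. F (env_shift d \<xi>) \<partial>R)"
    using assms by (intro nn_integral_distr) auto
  then show ?thesis by (simp add: shift_invariant)
qed

lemma measurable_gap [measurable]: "(\<lambda>(s, \<xi>). gap \<xi> s) \<in> borel_measurable (borel \<Otimes>\<^sub>M R)"
  unfolding gap_def split_beta' by measurable

lemma measurable_mean_gap [measurable]: "mean_gap \<in> borel_measurable borel"
  unfolding mean_gap_def[abs_def] by measurable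

interpretation lebesgue_env: pair_sigma_finite lborel R ..

text \<open>
  Stationarity enters here and only here: it replaces the environment seen from a neighbour of the
  origin by the environment itself.
\<close>

lemma annealed_renewal_equation:
  assumes "0 \<le> t"
  shows "(\<integral>\<^sup>+\<xi>. expect_max f \<xi> t \<partial>R) +
      (\<integral>\<^sup>+s. (\<integral>\<^sup>+\<xi>. ennreal (1 + \<xi> 0) * expect_max f \<xi> s \<partial>R) * indicator {0..<t} s \<partial>lborel) =
    f 0 + (\<integral>\<^sup>+s. (\<integral>\<^sup>+\<xi>. shifted_source f \<xi> s \<partial>R) * indicator {0..<t} s \<partial>lborel)"
proof -
  note [measurable] = measurable_env_apply
  have swap: "(\<integral>\<^sup>+\<xi>. (\<integral>\<^sup>+s. F \<xi> s * indicator {0..<t} s \<partial>lborel) \<partial>R) =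
     (\<integral>\<^sup>+s. (\<integral>\<^sup>+\<xi>. F \<xi> s \<partial>R) * indicator {0..<t} s \<partial>lborel)"
    if [measurable]: "(\<lambda>(s, \<xi>). F \<xi> s) \<in> borel_measurable (borel \<Otimes>\<^sub>M R)" for F :: "(int \<Rightarrow> real) \<Rightarrow> real \<Rightarrow> ennreal"
  proof -
    have "(\<integral>\<^sup>+\<xi>. (\<integral>\<^sup>+s. F \<xi> s * indicator {0..<t} s \<partial>lborel) \<partial>R) =
        (\<integral>\<^sup>+s. (\<integral>\<^sup>+\<xi>. F \<xi> s * indicator {0..<t} s \<partial>R) \<partial>lborel)"
      by (rule lebesgue_env.Fubini') measurable
    also have "\<dots> = (\<integral>\<^sup>+s. (\<integral>\<^sup>+\<xi>. F \<xi> s \<partial>R) * indicator {0..<t} s \<partial>lborel)"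
      by (intro nn_integral_cong nn_integral_multc) measurable
    finally show ?thesis .
  qed
  have "AE \<xi> in R. expect_max f \<xi> t + (\<integral>\<^sup>+s. ennreal (1 + \<xi> 0) * expect_max f \<xi> s * indicator {0..<t} s \<partial>lborel) =
      f 0 + (\<integral>\<^sup>+s. branching_source f \<xi> s * indicator {0..<t} s \<partial>lborel)"
    using AE_rates
  proof eventually_elim
    case (elim \<xi>)
    have "(\<integral>\<^sup>+s. ennreal (1 + \<xi> 0) * expect_max f \<xi> s * indicator {0..<t} s \<partial>lborel) =
        ennreal (1 + \<xi> 0) * (\<integral>\<^sup>+s. expect_max f \<xi> s * indicator {0..<t} s \<partial>lborel)"
      by (subst nn_integral_cmult[symmetric]) (auto simp: mult.assoc)
    then show ?case using integrated_renewal_equation[of \<xi> b t f] elim assms by simp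
  qed
  then have "(\<integral>\<^sup>+\<xi>. expect_max f \<xi> t + (\<integral>\<^sup>+s. ennreal (1 + \<xi> 0) * expect_max f \<xi> s * indicator {0..<t} s \<partial>lborel) \<partial>R) =
      (\<integral>\<^sup>+\<xi>. f 0 + (\<integral>\<^sup>+s. branching_source f \<xi> s * indicator {0..<t} s \<partial>lborel) \<partial>R)"
    by (rule nn_integral_cong_AE)
  also have "(\<integral>\<^sup>+\<xi>. expect_max f \<xi> t + (\<integral>\<^sup>+s. ennreal (1 + \<xi> 0) * expect_max f \<xi> s * indicator {0..<t} s \<partial>lborel) \<partial>R) =
     (\<integral>\<^sup>+\<xi>. expect_max f \<xi> t \<partial>R) + (\<integral>\<^sup>+s. (\<integral>\<^sup>+\<xi>. ennreal (1 + \<xi> 0) * expect_max f \<xi> s \<partial>R) * indicator {0..<t} s \<partial>lborel)"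
    by (subst nn_integral_add, measurable) (subst swap, measurable)
  also have "(\<integral>\<^sup>+\<xi>. f 0 + (\<integral>\<^sup>+s. branching_source f \<xi> s * indicator {0..<t} s \<partial>lborel) \<partial>R) =
     f 0 + (\<integral>\<^sup>+s. (\<integral>\<^sup>+\<xi>. branching_source f \<xi> s \<partial>R) * indicator {0..<t} s \<partial>lborel)"
    by (subst nn_integral_add, measurable)
       (subst swap, measurable, simp add: emeasure_space_1)
  also have "\<dots> = f 0 + (\<integral>\<^sup>+s. (\<integral>\<^sup>+\<xi>. shifted_source f \<xi> s \<partial>R) * indicator {0..<t} s \<partial>lborel)"
  proof -
    have "(\<integral>\<^sup>+\<xi>. expect_max g (env_shift d \<xi>) s \<partial>R) = (\<integral>\<^sup>+\<xi>. expect_max g \<xi> s \<partial>R)" for g d s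
      by (rule nn_integral_env_shift) measurable
    then have "(\<integral>\<^sup>+\<xi>. branching_source f \<xi> s \<partial>R) = (\<integral>\<^sup>+\<xi>. shifted_source f \<xi> s \<partial>R)" for s
      unfolding branching_source_def shifted_source_def
      by (simp add: nn_integral_add nn_integral_divide)
    then show ?thesis by simp
  qed
  finally show ?thesis .
qed

text \<open>
  Subtracting the annealed equation for the negative part of the maximum from the one for the
  positive part gives \<open>E M = \<integral>\<^sub>0\<^sup>t E [\<xi> 0 * gap \<xi> s] ds\<close>, and \<open>E M \<le> growth_rate * t\<close>. In the proof
  \<open>A\<close>, \<open>X\<close>, \<open>S\<close> and \<open>G\<close> are the terms of the equation: annealed mean, loss, source and gap.
\<close>

theorem integrated_gap_le:
  assumes t: "0 \<le> t"
  shows "(\<integral>\<^sup>+s. (\<integral>\<^sup>+\<xi>. ennreal (\<xi> 0) * gap \<xi> s \<partial>R) * indicator {0..<t} s \<partial>lborel) \<le> ennreal (growth_rate * t)"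
proof -
  note [measurable] = measurable_env_apply
  let ?q = "\<lambda>k. pos_part (- k)"
  define A where "A f = (\<integral>\<^sup>+\<xi>. expect_max f \<xi> t \<partial>R)" for f
  define X where "X f = (\<integral>\<^sup>+s. (\<integral>\<^sup>+\<xi>. ennreal (1 + \<xi> 0) * expect_max f \<xi> s \<partial>R) * indicator {0..<t} s \<partial>lborel)" for f
  define S where "S f = (\<integral>\<^sup>+s. (\<integral>\<^sup>+\<xi>. shifted_source f \<xi> s \<partial>R) * indicator {0..<t} s \<partial>lborel)" for f
  define G where "G = (\<integral>\<^sup>+s. (\<integral>\<^sup>+\<xi>. ennreal (\<xi> 0) * gap \<xi> s \<partial>R) * indicator {0..<t} s \<partial>lborel)"
  have renewal: "A f + X f = f 0 + S f" for f
    using annealed_renewal_equation[OF t] by (simp add: A_def X_def S_def)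
  have balance: "S pos_part + X ?q = S ?q + X pos_part + G"
  proof -
    have "(\<integral>\<^sup>+\<xi>. shifted_source pos_part \<xi> s + ennreal (1 + \<xi> 0) * expect_max ?q \<xi> s \<partial>R) =
      (\<integral>\<^sup>+\<xi>. shifted_source ?q \<xi> s + ennreal (1 + \<xi> 0) * expect_max pos_part \<xi> s + ennreal (\<xi> 0) * gap \<xi> s \<partial>R)" for s
      by (rule nn_integral_cong_elliptic) (simp add: source_balance)
    then have "(\<integral>\<^sup>+\<xi>. shifted_source pos_part \<xi> s \<partial>R) + (\<integral>\<^sup>+\<xi>. ennreal (1 + \<xi> 0) * expect_max ?q \<xi> s \<partial>R) =
      (\<integral>\<^sup>+\<xi>. shifted_source ?q \<xi> s \<partial>R) + (\<integral>\<^sup>+\<xi>. ennreal (1 + \<xi> 0) * expect_max pos_part \<xi> s \<partial>R) +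
      (\<integral>\<^sup>+\<xi>. ennreal (\<xi> 0) * gap \<xi> s \<partial>R)" for s
      by (simp add: nn_integral_add)
    then have "(\<integral>\<^sup>+s. ((\<integral>\<^sup>+\<xi>. shifted_source pos_part \<xi> s \<partial>R) + (\<integral>\<^sup>+\<xi>. ennreal (1 + \<xi> 0) * expect_max ?q \<xi> s \<partial>R)) * indicator {0..<t} s \<partial>lborel) =
      (\<integral>\<^sup>+s. ((\<integral>\<^sup>+\<xi>. shifted_source ?q \<xi> s \<partial>R) + (\<integral>\<^sup>+\<xi>. ennreal (1 + \<xi> 0) * expect_max pos_part \<xi> s \<partial>R) +
      (\<integral>\<^sup>+\<xi>. ennreal (\<xi> 0) * gap \<xi> s \<partial>R)) * indicator {0..<t} s \<partial>lborel)"
      by simp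
    then show ?thesis
      unfolding S_def X_def G_def distrib_right
      by (simp add: nn_integral_add)
  qed
  have A_fin: "A ?q < \<infinity>"
  proof -
    have "A ?q \<le> (\<integral>\<^sup>+\<xi>. ennreal (exp (growth_rate * t)) \<partial>R)"
      unfolding A_def
      using t by (intro nn_integral_mono_elliptic) (simp add: growth_rate_def expect_max_parts_le)
    also have "\<dots> < \<infinity>" by (simp add: emeasure_space_1)
    finally show ?thesis .
  qed
  have X_fin: "X f < \<infinity>" if f: "f = pos_part \<or> f = ?q" for f
  proof -
    have le: "expect_max f \<xi> s \<le> ennreal (exp (growth_rate * t))"
      if "\<forall>x. 0 < \<xi> x" "\<forall>x. \<xi> x \<le> b" "0 \<le> s" "s < t" for \<xi> s
    proof -
      have "expect_max f \<xi> s \<le> ennreal (exp (growth_rate * s))"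
        using f expect_max_parts_le[OF that(1-3)] by (auto simp: growth_rate_def)
      also have "\<dots> \<le> ennreal (exp (growth_rate * t))"
        using that growth_rate_pos by (intro ennreal_leI) (simp add: mult_left_mono)
      finally show ?thesis .
    qed
    have "(\<integral>\<^sup>+\<xi>. ennreal (1 + \<xi> 0) * expect_max f \<xi> s \<partial>R) \<le> ennreal ((1 + b) * exp (growth_rate * t))"
      if s: "0 \<le> s" "s < t" for s
    proof -
      have "(\<integral>\<^sup>+\<xi>. ennreal (1 + \<xi> 0) * expect_max f \<xi> s \<partial>R) \<le> (\<integral>\<^sup>+\<xi>. ennreal (1 + b) * ennreal (exp (growth_rate * t)) \<partial>R)"
        using s by (intro nn_integral_mono_elliptic mult_mono ennreal_leI le) auto
      also have "\<dots> = ennreal ((1 + b) * exp (growth_rate * t))"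
        using b_pos by (simp add: emeasure_space_1 ennreal_mult)
      finally show ?thesis .
    qed
    then have "X f \<le> (\<integral>\<^sup>+s. ennreal ((1 + b) * exp (growth_rate * t)) * indicator {0..<t} s \<partial>lborel)"
      unfolding X_def by (intro nn_integral_mono) (auto simp: indicator_def)
    also have "\<dots> < \<infinity>"
      using t by (simp add: nn_integral_cmult_indicator ennreal_mult_less_top)
    finally show ?thesis .
  qed
  (* Both losses are added to the two equations, and are cancelled once they stand on both sides;
     being finite, they can be. *)
  have "A pos_part + X pos_part + X ?q = S pos_part + X ?q"
    using renewal[of pos_part] by (simp add: pos_part_def)
  also have "\<dots> = (A ?q + X ?q) + X pos_part + G"
    using balance renewal[of ?q] by (simp add: pos_part_def)
  finally have "(X pos_part + X ?q) + A pos_part = (X pos_part + X ?q) + (A ?q + G)"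
    by (simp add: add_ac)
  then have "A ?q + G = A pos_part"
    using X_fin[of pos_part] X_fin[of ?q] by (auto simp: ennreal_add_left_cancel)
  also have "A pos_part \<le> (\<integral>\<^sup>+\<xi>. expect_max ?q \<xi> t + ennreal (growth_rate * t) \<partial>R)"
    unfolding A_def
    using t by (intro nn_integral_mono_elliptic) (simp add: growth_rate_def expect_max_linear)
  also have "\<dots> = A ?q + ennreal (growth_rate * t)"
    unfolding A_def by (subst nn_integral_add) (auto simp: emeasure_space_1)
  finally show ?thesis
    using A_fin by (auto simp: G_def ennreal_add_left_cancel_le)
qed

corollary integrated_mean_gap_le:
  assumes "0 \<le> t"
  shows "ennreal a * (\<integral>\<^sup>+s. mean_gap s * indicator {0..<t} s \<partial>lborel) \<le> ennreal (growth_rate * t)"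
proof -
  note [measurable] = measurable_env_apply
  have "(\<integral>\<^sup>+\<xi>. ennreal a * gap \<xi> s \<partial>R) = ennreal a * mean_gap s" for s
    unfolding mean_gap_def by (rule nn_integral_cmult) measurable
  then have "ennreal a * (\<integral>\<^sup>+s. mean_gap s * indicator {0..<t} s \<partial>lborel) =
      (\<integral>\<^sup>+s. (\<integral>\<^sup>+\<xi>. ennreal a * gap \<xi> s \<partial>R) * indicator {0..<t} s \<partial>lborel)"
    by (simp add: mult.assoc nn_integral_cmult)
  also have "\<dots> \<le> (\<integral>\<^sup>+s. (\<integral>\<^sup>+\<xi>. ennreal (\<xi> 0) * gap \<xi> s \<partial>R) * indicator {0..<t} s \<partial>lborel)"
    by (intro nn_integral_mono mult_right_mono nn_integral_mono_elliptic ennreal_leI) auto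
  also have "\<dots> \<le> ennreal (growth_rate * t)"
    by (rule integrated_gap_le[OF assms])
  finally show ?thesis .
qed

lemma mean_gap_persists:
  assumes "0 \<le> t" "0 \<le> h"
  shows "ennreal (exp (- 2 * (1 + b) * h)) * mean_gap t \<le> mean_gap (t + h)"
proof -
  have "ennreal (exp (- 2 * (1 + b) * h)) * mean_gap t = (\<integral>\<^sup>+\<xi>. ennreal (exp (- 2 * (1 + b) * h)) * gap \<xi> t \<partial>R)"
    unfolding mean_gap_def by (subst nn_integral_cmult) auto
  also have "\<dots> \<le> mean_gap (t + h)"
    unfolding mean_gap_def
    by (intro nn_integral_mono_elliptic gap_persists assms)
  finally show ?thesis .
qed

text \<open>
  By persistence, the gap at a lattice time bounds the gap from below on the whole following cell.
  The cells are disjoint subsets of \<open>[0, (n + 2) * h)\<close>: the last one ends at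
  \<open>(n + 1) * h + \<eta> \<le> (n + 2) * h\<close>.
\<close>

theorem lattice_sum_mean_gap_le:
  assumes h: "0 < h" and \<eta>: "0 \<le> \<eta>" "\<eta> \<le> h"
  shows "(\<Sum>k=1..n. mean_gap (real k * h + \<eta>)) \<le>
    ennreal (growth_rate / a * exp (2 * (1 + b) * h) * real (n + 2))"
proof -
  let ?e = "exp (- 2 * (1 + b) * h)"
  let ?I = "\<lambda>k. {real k * h + \<eta>..<real (Suc k) * h + \<eta>}"
  define T where "T = real (n + 2) * h"
  have cell: "ennreal (?e * h) * mean_gap (real k * h + \<eta>) \<le> (\<integral>\<^sup>+s. mean_gap s * indicator (?I k) s \<partial>lborel)" for k
  proof -
    let ?t = "real k * h + \<eta>"
    have t: "0 \<le> ?t" using h \<eta> by simp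
    have I: "emeasure lborel (?I k) = ennreal h"
      using h by (simp add: ring_distribs)
    have e: "ennreal (?e * h) = ennreal ?e * ennreal h"
      using h by (intro ennreal_mult) auto
    have "ennreal (?e * h) * mean_gap ?t = (ennreal ?e * mean_gap ?t) * emeasure lborel (?I k)"
      unfolding I e by (simp only: mult_ac)
    also have "\<dots> = (\<integral>\<^sup>+s. ennreal ?e * mean_gap ?t * indicator (?I k) s \<partial>lborel)"
      by (rule nn_integral_cmult_indicator[symmetric]) simp
    also have "\<dots> \<le> (\<integral>\<^sup>+s. mean_gap s * indicator (?I k) s \<partial>lborel)"
    proof (rule nn_integral_mono)
      fix s
      have "ennreal ?e * mean_gap ?t \<le> mean_gap s" if s: "s \<in> ?I k"
      proof -
      from s have u: "0 \<le> s - ?t" "s - ?t \<le> h" by (auto simp: algebra_simps)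
      have "ennreal ?e * mean_gap ?t \<le> ennreal (exp (- 2 * (1 + b) * (s - ?t))) * mean_gap ?t"
        using u b_pos by (intro mult_right_mono ennreal_leI) (auto simp: mult_left_mono)
      also have "\<dots> \<le> mean_gap (?t + (s - ?t))"
        by (rule mean_gap_persists[OF t u(1)])
      finally show ?thesis by simp
      qed
      then show "ennreal ?e * mean_gap ?t * indicator (?I k) s \<le> mean_gap s * indicator (?I k) s"
        by (simp add: indicator_def)
    qed
    finally show ?thesis .
  qed
  have "ennreal (?e * h) * (\<Sum>k=1..n. mean_gap (real k * h + \<eta>)) \<le>
      (\<Sum>k=1..n. \<integral>\<^sup>+s. mean_gap s * indicator (?I k) s \<partial>lborel)"
    unfolding sum_distrib_left by (intro sum_mono cell)
  also have "\<dots> = (\<integral>\<^sup>+s. (\<Sum>k=1..n. mean_gap s * indicator (?I k) s) \<partial>lborel)"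
    by (subst nn_integral_sum) auto
  also have "\<dots> \<le> (\<integral>\<^sup>+s. mean_gap s * indicator {0..<T} s \<partial>lborel)"
  proof (rule nn_integral_mono)
    fix s :: real
    have disj: "k = k'" if "s \<in> ?I k" "s \<in> ?I k'" for k k'
    proof -
      have "k \<le> k'" if "s \<in> ?I k" "s \<in> ?I k'" for k k'
      proof -
        have "real k * h < real (Suc k') * h" using that by auto
        then show ?thesis using h by simp
      qed
      from this[OF that] this[OF that(2,1)] show ?thesis by simp
    qed
    have sub: "s \<in> {0..<T}" if "k \<in> {1..n}" "s \<in> ?I k" for k
    proof -
      have "real (Suc k) * h + \<eta> \<le> real (n + 1) * h + h"
        using that(1) h \<eta> by (intro add_mono mult_right_mono) auto
      moreover have "0 \<le> real k * h" using h by simp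
      moreover have "real k * h + \<eta> \<le> s" "s < real (Suc k) * h + \<eta>" using that(2) by auto
      moreover have "T = real (n + 1) * h + h" by (simp add: T_def algebra_simps)
      ultimately have "0 \<le> s" "s < T" using \<eta> by linarith+
      then show ?thesis by simp
    qed
    have "(\<Sum>k=1..n. indicator (?I k) s :: ennreal) \<le> indicator {0..<T} s"
    proof (cases "\<exists>k\<in>{1..n}. s \<in> ?I k")
      case True
      then obtain k where k: "k \<in> {1..n}" "s \<in> ?I k" by blast
      have "(\<Sum>k=1..n. indicator (?I k) s :: ennreal) = (\<Sum>j\<in>{k}. indicator (?I j) s)"
      proof (rule sum.mono_neutral_right)
        show "\<forall>j\<in>{1..n} - {k}. indicator (?I j) s = (0 :: ennreal)"
        proof
          fix j assume "j \<in> {1..n} - {k}"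
          then have "s \<notin> ?I j" using disj[of j k] k(2) by blast
          then show "indicator (?I j) s = (0 :: ennreal)" by (rule indicator_simps(2))
        qed
      qed (use k(1) in auto)
      also have "\<dots> = indicator {0..<T} s"
        using k(2) sub[OF k] by (simp only: sum.insert_if finite.emptyI empty_iff if_False sum.empty indicator_simps add_0_right)
      finally show ?thesis by simp
    next
      case False
      then have "(\<Sum>k=1..n. indicator (?I k) s :: ennreal) = 0"
        by (intro sum.neutral) (meson indicator_simps(2))
      then show ?thesis by simp
    qed
    then show "(\<Sum>k=1..n. mean_gap s * indicator (?I k) s) \<le> mean_gap s * indicator {0..<T} s"
      unfolding sum_distrib_left[symmetric] by (rule mult_left_mono) simp
  qed
  finally have "ennreal a * (ennreal (?e * h) * (\<Sum>k=1..n. mean_gap (real k * h + \<eta>))) \<le>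
      ennreal a * (\<integral>\<^sup>+s. mean_gap s * indicator {0..<T} s \<partial>lborel)"
    by (rule mult_left_mono) simp
  also have "\<dots> \<le> ennreal (growth_rate * T)"
    using h by (intro integrated_mean_gap_le) (simp add: T_def)
  finally have "ennreal (a * ?e * h) * (\<Sum>k=1..n. mean_gap (real k * h + \<eta>)) \<le> ennreal (growth_rate * T)"
    using a_pos h by (simp add: ennreal_mult mult.assoc)
  then have "ennreal (1 / (a * ?e * h)) * (ennreal (a * ?e * h) * (\<Sum>k=1..n. mean_gap (real k * h + \<eta>))) \<le>
      ennreal (1 / (a * ?e * h)) * ennreal (growth_rate * T)"
    by (rule mult_left_mono) simp
  moreover have "ennreal (1 / (a * ?e * h)) * ennreal (a * ?e * h) = 1"
    using a_pos h by (subst ennreal_mult[symmetric]) auto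
  moreover have "ennreal (1 / (a * ?e * h)) * ennreal (growth_rate * T) =
      ennreal (growth_rate / a * exp (2 * (1 + b) * h) * real (n + 2))"
  proof -
    define E where "E = exp (2 * (1 + b) * h)"
    have "- 2 * (1 + b) * h = - (2 * (1 + b) * h)" by (simp only: mult_minus_left)
    then have e: "?e = inverse E" by (simp only: exp_minus E_def)
    have "0 < E" by (simp add: E_def)
    then show ?thesis
      using a_pos h growth_rate_pos unfolding e E_def[symmetric]
      by (subst ennreal_mult[symmetric]) (auto simp: T_def field_simps)
  qed
  ultimately show ?thesis by (simp add: mult.assoc[symmetric])
qed

end

section \<open>Deviation from the quenched mean\<close>

text \<open>
  The quenched mean is the mean of an independent copy, so by Jensen's inequality the deviation from
  it is on average at most the distance to that copy.
\<close>

lemma quenched_deviation_le_gap: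
  assumes "\<forall>x. 0 < \<xi> x" "\<forall>x. \<xi> x \<le> b" "0 \<le> t"
  shows "(\<integral>\<^sup>+c. ennreal \<bar>max_particle \<xi> c t - quenched_mean_max \<xi> t\<bar> \<partial>clock_space) \<le> 2 * gap \<xi> t"
proof -
  let ?M = "\<lambda>c. real_of_int (rightmost \<xi> c t)"
  interpret CC: pair_sigma_finite clock_space clock_space ..
  have abs: "ennreal \<bar>real_of_int k\<bar> = pos_part k + pos_part (- k)" for k
    by (auto simp: pos_part_def abs_if ennreal_neg)
  have int: "integrable clock_space ?M"
  proof (rule integrableI_bounded)
    have "(\<integral>\<^sup>+c. ennreal (norm (?M c)) \<partial>clock_space) = expect_max pos_part \<xi> t + expect_max (\<lambda>k. pos_part (- k)) \<xi> t"
      unfolding real_norm_def abs expect_max_def by (rule nn_integral_add) measurable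
    also have "\<dots> \<le> ennreal (exp ((cosh 1 - 1 + b) * t)) + ennreal (exp ((cosh 1 - 1 + b) * t))"
      by (intro add_mono expect_max_parts_le assms)
    also have "\<dots> < \<infinity>" by simp
    finally show "(\<integral>\<^sup>+c. ennreal (norm (?M c)) \<partial>clock_space) < \<infinity>" .
  qed measurable
  have le: "ennreal \<bar>?M c - (\<integral>c'. ?M c' \<partial>clock_space)\<bar> \<le>
      (\<integral>\<^sup>+c'. pos_part (rightmost \<xi> c' t - rightmost \<xi> c t) + pos_part (rightmost \<xi> c t - rightmost \<xi> c' t) \<partial>clock_space)" for c
  proof -
    have int': "integrable clock_space (\<lambda>c'. ?M c' - ?M c)"
      using int by simp
    have "(\<integral>c'. ?M c' - ?M c \<partial>clock_space) = (\<integral>c'. ?M c' \<partial>clock_space) - ?M c"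
      using int clock_space.prob_space by simp
    then have "ennreal \<bar>?M c - (\<integral>c'. ?M c' \<partial>clock_space)\<bar> = ennreal (norm (\<integral>c'. ?M c' - ?M c \<partial>clock_space))"
      by (simp add: abs_minus_commute)
    also have "\<dots> \<le> ennreal (\<integral>c'. norm (?M c' - ?M c) \<partial>clock_space)"
      by (intro ennreal_leI integral_norm_bound)
    also have "\<dots> = (\<integral>\<^sup>+c'. ennreal (norm (?M c' - ?M c)) \<partial>clock_space)"
      using int' by (intro nn_integral_eq_integral[symmetric]) auto
    also have "\<dots> = (\<integral>\<^sup>+c'. pos_part (rightmost \<xi> c' t - rightmost \<xi> c t) + pos_part (rightmost \<xi> c t - rightmost \<xi> c' t) \<partial>clock_space)"
      unfolding real_norm_def of_int_diff[symmetric] abs by simp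
    finally show ?thesis .
  qed
  have "(\<integral>\<^sup>+c. ennreal \<bar>max_particle \<xi> c t - quenched_mean_max \<xi> t\<bar> \<partial>clock_space) \<le>
      (\<integral>\<^sup>+c. \<integral>\<^sup>+c'. pos_part (rightmost \<xi> c' t - rightmost \<xi> c t) +
         pos_part (rightmost \<xi> c t - rightmost \<xi> c' t) \<partial>clock_space \<partial>clock_space)"
    unfolding quenched_mean_max_def max_particle_eq by (intro nn_integral_mono le)
  also have "\<dots> = gap \<xi> t + (\<integral>\<^sup>+c. \<integral>\<^sup>+c'. pos_part (rightmost \<xi> c t - rightmost \<xi> c' t) \<partial>clock_space \<partial>clock_space)"
    unfolding gap_def expect_max2_def by (simp add: nn_integral_add)
  also have "(\<integral>\<^sup>+c. \<integral>\<^sup>+c'. pos_part (rightmost \<xi> c t - rightmost \<xi> c' t) \<partial>clock_space \<partial>clock_space) = gap \<xi> t"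
    unfolding gap_def expect_max2_def by (rule CC.Fubini'[symmetric]) simp
  finally show ?thesis by (simp add: mult_2)
qed

lemma measurable_max_particle [measurable (raw)]:
  assumes "f \<in> N \<rightarrow>\<^sub>M env_space" "g \<in> N \<rightarrow>\<^sub>M clock_space" "h \<in> borel_measurable N"
  shows "(\<lambda>w. max_particle (f w) (g w) (h w)) \<in> borel_measurable N"
  unfolding max_particle_eq by (rule measurable_rightmost_fun[OF assms])

lemma measurable_quenched_mean_max [measurable (raw)]:
  assumes [measurable]: "f \<in> N \<rightarrow>\<^sub>M env_space"
  shows "(\<lambda>w. quenched_mean_max (f w) t) \<in> borel_measurable N"
proof -
  have "(\<lambda>(w, c). max_particle (f w) c t) \<in> borel_measurable (N \<Otimes>\<^sub>M clock_space)"
    unfolding split_beta' by measurable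
  then show ?thesis
    unfolding quenched_mean_max_def by (rule clock_space.borel_measurable_lebesgue_integral)
qed

context
  fixes Q :: "'w measure" and \<xi> :: "int \<Rightarrow> 'w \<Rightarrow> real"
  assumes meas: "\<And>x. \<xi> x \<in> borel_measurable Q"
begin

lemma measurable_environment: "(\<lambda>w x. \<xi> x w) \<in> Q \<rightarrow>\<^sub>M env_space"
  by (rule measurable_PiM_single') (use meas in \<open>auto simp: space_PiM\<close>)

lemma measurable_centred_max: "centred_max \<xi> t \<in> borel_measurable (annealed Q)"
proof -
  note [measurable] = measurable_environment
  have [measurable]: "(\<lambda>p. (\<lambda>x. \<xi> x (fst p))) \<in> Q \<Otimes>\<^sub>M clock_space \<rightarrow>\<^sub>M env_space"
    by (rule measurable_compose[OF measurable_fst measurable_environment])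
  show ?thesis
    unfolding centred_max_def annealed_def split_beta' by measurable
qed

end

section \<open>Times with a small gap\<close>

text \<open>
  If the threshold is \<open>K = C * (1 + \<delta>) / \<delta>\<close>, then at most \<open>C * (n + 2) / K = \<delta> / (1 + \<delta>) * (n + 2)\<close> of
  the indices up to \<open>n\<close> exceed it. Hence \<open>n \<le> (1 + \<delta>) * m + 2 * \<delta>\<close> when \<open>m\<close> of them do not; take for
  \<open>n\<close> the \<open>m\<close>-th of these. Indices of \<open>g\<close> start at \<open>0\<close>, whence the \<^const>\<open>Suc\<close>.
\<close>

lemma frequently_small_terms:
  fixes x :: "nat \<Rightarrow> ennreal" and C \<delta> :: real
  assumes C: "0 < C" and \<delta>: "0 < \<delta>"
    and sums: "\<And>n. (\<Sum>k=1..n. x k) \<le> ennreal (C * real (n + 2))"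
  obtains g :: "nat \<Rightarrow> nat" where "strict_mono g" "\<And>k. 1 \<le> g k"
    "\<And>k. x (g k) \<le> ennreal (C * (1 + \<delta>) / \<delta>)"
    "\<And>k. real (g k) \<le> (1 + \<delta>) * real (Suc k) + 2 * \<delta>"
proof -
  define K where "K = C * (1 + \<delta>) / \<delta>"
  define G where "G = {k. 1 \<le> k \<and> x k \<le> ennreal K}"
  have K: "0 < K" using C \<delta> by (simp add: K_def)
  have count: "real n \<le> (1 + \<delta>) * real (card (G \<inter> {1..n})) + 2 * \<delta>" for n
  proof -
    let ?B = "{1..n} - G"
    have "ennreal (K * real (card ?B)) = (\<Sum>k\<in>?B. ennreal K)"
      using K by (simp add: ennreal_mult mult.commute ennreal_of_nat_eq_real_of_nat)
    also have "\<dots> \<le> (\<Sum>k\<in>?B. x k)"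
      by (intro sum_mono) (auto simp: G_def)
    also have "\<dots> \<le> (\<Sum>k=1..n. x k)"
      by (intro sum_mono2) auto
    also note sums
    finally have "K * real (card ?B) \<le> C * real (n + 2)"
      using C by (subst (asm) ennreal_le_iff) auto
    then have "C * ((1 + \<delta>) * real (card ?B)) \<le> C * (\<delta> * real (n + 2))"
      using \<delta> by (simp add: K_def field_simps)
    then have "(1 + \<delta>) * real (card ?B) \<le> \<delta> * real (n + 2)"
      using C by simp
    moreover have "card {1..n} = card (G \<inter> {1..n}) + card ?B"
      using card_Int_Diff[of "{1..n}" G] by (simp add: Int_commute)
    then have "real n = real (card (G \<inter> {1..n})) + real (card ?B)" by simp
    ultimately show ?thesis by (simp add: algebra_simps)
  qed
  have inf: "infinite G"
  proof
    assume fin: "finite G"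
    obtain n :: nat where n: "(1 + \<delta>) * real (card G) + 2 * \<delta> < real n"
      using reals_Archimedean2 by blast
    have "card (G \<inter> {1..n}) \<le> card G" using fin by (intro card_mono) auto
    then have "(1 + \<delta>) * real (card (G \<inter> {1..n})) \<le> (1 + \<delta>) * real (card G)"
      using \<delta> by (intro mult_left_mono) auto
    with count[of n] n show False by linarith
  qed
  have mono: "strict_mono (enumerate G)"
    using inf by (rule strict_mono_enumerate)
  have in_G: "enumerate G k \<in> G" for k
    using inf by (rule enumerate_in_set)
  have card: "card (G \<inter> {1..enumerate G k}) = Suc k" for k
  proof -
    have "G \<inter> {1..enumerate G k} = enumerate G ` {..k}"
    proof (intro equalityI subsetI)
      fix m assume m: "m \<in> G \<inter> {1..enumerate G k}"
      then obtain j where j: "m = enumerate G j"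
        using range_enumerate[OF inf] by blast
      with m have "j \<le> k" using strict_mono_less_eq[OF mono] by auto
      with j show "m \<in> enumerate G ` {..k}" by auto
    next
      fix m assume "m \<in> enumerate G ` {..k}"
      then show "m \<in> G \<inter> {1..enumerate G k}"
        using in_G strict_mono_less_eq[OF mono] by (auto simp: G_def)
    qed
    then show ?thesis
      using strict_mono_imp_inj_on[OF mono] by (simp add: card_image inj_on_subset)
  qed
  show thesis
  proof (rule that[of "enumerate G"])
    show "real (enumerate G k) \<le> (1 + \<delta>) * real (Suc k) + 2 * \<delta>" for k
      using count[of "enumerate G k"] by (simp only: card)
  qed (use mono in_G in \<open>auto simp: G_def K_def\<close>)
qed

section \<open>Tightness along a subsequence\<close>

lemma tight_if_bounded_mean:
  fixes Y :: "nat \<Rightarrow> 'a \<Rightarrow> real"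
  assumes "prob_space P" and [measurable]: "\<And>k. Y k \<in> borel_measurable P"
    and K: "0 \<le> K" and bound: "\<And>k. (\<integral>\<^sup>+p. ennreal \<bar>Y k p\<bar> \<partial>P) \<le> ennreal K"
  shows "tight (\<lambda>k. distr P borel (Y k))"
  unfolding tight_def
proof (intro conjI allI impI)
  interpret prob_space P by fact
  show "real_distribution (distr P borel (Y k))" for k
    by (rule real_distribution_distr) simp
  fix \<epsilon> :: real
  assume \<epsilon>: "0 < \<epsilon>"
  define \<alpha> where "\<alpha> = K / \<epsilon> + 1"
  have \<alpha>: "0 < \<alpha>" using K \<epsilon> by (simp add: \<alpha>_def add_nonneg_pos)
  have "K < \<epsilon> * \<alpha>" using \<epsilon> by (simp add: \<alpha>_def field_simps)
  then have \<alpha>': "K / \<alpha> < \<epsilon>" using \<alpha> by (simp add: field_simps)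
  have "measure (distr P borel (Y k)) {-\<alpha><..\<alpha>} > 1 - \<epsilon>" for k
  proof -
    let ?B = "{p \<in> space P. \<alpha> \<le> \<bar>Y k p\<bar>}"
    have "emeasure P ?B = (\<integral>\<^sup>+p. indicator ?B p \<partial>P)" by simp
    also have "\<dots> \<le> (\<integral>\<^sup>+p. ennreal (1 / \<alpha>) * ennreal \<bar>Y k p\<bar> \<partial>P)"
      using \<alpha> by (intro nn_integral_mono) (auto simp: indicator_def ennreal_mult[symmetric] field_simps)
    also have "\<dots> = ennreal (1 / \<alpha>) * (\<integral>\<^sup>+p. ennreal \<bar>Y k p\<bar> \<partial>P)"
      by (rule nn_integral_cmult) simp
    also have "\<dots> \<le> ennreal (1 / \<alpha>) * ennreal K"
      by (intro mult_left_mono bound) simp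
    also have "\<dots> = ennreal (K / \<alpha>)"
      using K \<alpha> by (simp add: ennreal_mult[symmetric])
    finally have B: "prob ?B \<le> K / \<alpha>"
      using K \<alpha> by (simp add: emeasure_eq_measure)
    have "1 - prob ?B = prob (space P - ?B)"
      by (rule prob_compl[symmetric]) simp
    also have "\<dots> \<le> prob (Y k -` {-\<alpha><..\<alpha>} \<inter> space P)"
      by (intro finite_measure_mono) auto
    also have "\<dots> = measure (distr P borel (Y k)) {-\<alpha><..\<alpha>}"
      by (simp add: measure_distr)
    finally show ?thesis using B \<alpha>' by linarith
  qed
  then show "\<exists>a b. a < b \<and> (\<forall>k. measure (distr P borel (Y k)) {a<..b} > 1 - \<epsilon>)"
    using \<alpha> by (intro exI[of _ "-\<alpha>"] exI[of _ \<alpha>]) auto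
qed

lemma essinf_esssup_bounds:
  assumes X: "X \<in> borel_measurable Q"
    and pos: "0 < essinf Q (\<lambda>w. ereal (X w))" and fin: "esssup Q (\<lambda>w. ereal (X w)) < \<infinity>"
  obtains a b :: real where "0 < a" "AE w in Q. a \<le> X w \<and> X w \<le> b"
proof -
  obtain z where z: "AE w in Q. z \<le> ereal (X w)" "0 < z"
    using pos unfolding essinf_def less_Sup_iff by blast
  obtain a where a: "0 < a" "ereal a \<le> z"
  proof (cases z)
    case (real r) then show ?thesis using z(2) that[of r] by simp
  next
    case PInf then show ?thesis using that[of 1] by simp
  qed (use z in auto)
  obtain b where b: "esssup Q (\<lambda>w. ereal (X w)) \<le> ereal b"
    using fin by (cases "esssup Q (\<lambda>w. ereal (X w))") auto
  have "AE w in Q. a \<le> X w \<and> X w \<le> b"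
    using z(1) esssup_AE[of "\<lambda>w. ereal (X w)" Q]
  proof eventually_elim
    case (elim w)
    have "ereal a \<le> ereal (X w)"
      using a(2) elim(1) by (rule order_trans)
    moreover have "ereal (X w) \<le> ereal b"
      using elim(2) b by (rule order_trans)
    ultimately show ?case by simp
  qed
  with a(1) that show ?thesis by blast
qed

lemma iid_stationary_environment:
  fixes Q :: "'w measure" and \<xi> :: "int \<Rightarrow> 'w \<Rightarrow> real"
  assumes "prob_space Q"
    and indep: "prob_space.indep_vars Q (\<lambda>_. borel) \<xi> UNIV"
    and ident: "\<And>x. distr Q borel (\<xi> x) = distr Q borel (\<xi> 0)"
    and a: "0 < a" and bounds: "AE w in Q. a \<le> \<xi> 0 w \<and> \<xi> 0 w \<le> b"
  shows "stationary_environment (distr Q env_space (\<lambda>w x. \<xi> x w)) a b"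
proof -
  interpret prob_space Q by fact
  define \<mu> where "\<mu> = distr Q borel (\<xi> 0)"
  have meas [measurable]: "\<xi> x \<in> borel_measurable Q" for x
    using indep by (simp add: indep_vars_def)
  note env [measurable] = measurable_environment[OF meas]
  interpret \<mu>: prob_space \<mu>
    unfolding \<mu>_def by (rule prob_space_distr) simp
  have sets_\<mu>: "sets (PiM UNIV (\<lambda>_::int. \<mu>)) = sets env_space"
    by (intro sets_PiM_cong) (simp_all add: \<mu>_def)
  have R: "distr Q env_space (\<lambda>w x. \<xi> x w) = PiM UNIV (\<lambda>_. \<mu>)"
  proof -
    have "distr Q borel (\<xi> x) = \<mu>" for x
      unfolding \<mu>_def by (rule ident)
    moreover have "distr Q env_space (\<lambda>w. \<lambda>x\<in>UNIV. \<xi> x w) = PiM UNIV (\<lambda>x. distr Q borel (\<xi> x))"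
      using indep by (subst (asm) indep_vars_iff_distr_eq_PiM) auto
    ultimately show ?thesis by (simp only: restrict_UNIV)
  qed
  show ?thesis
  proof (intro stationary_environment.intro stationary_environment_axioms.intro a)
    show "prob_space (distr Q env_space (\<lambda>w x. \<xi> x w))"
      by (rule prob_space_distr) (rule env)
    show "sets (distr Q env_space (\<lambda>w x. \<xi> x w)) = sets env_space"
      by simp
    show "distr (distr Q env_space (\<lambda>w x. \<xi> x w)) env_space (env_shift d) = distr Q env_space (\<lambda>w x. \<xi> x w)" for d
    proof -
      have "distr (PiM UNIV (\<lambda>_. \<mu>)) (PiM UNIV (\<lambda>_. \<mu>)) (\<lambda>\<omega>. \<lambda>x\<in>UNIV. \<omega> (x + d)) = PiM UNIV (\<lambda>_. \<mu>)"
        by (rule distr_PiM_reindex[where M="\<lambda>_. \<mu>"]) (auto intro: \<mu>.prob_space_axioms simp: inj_on_def)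
      moreover have "distr (PiM UNIV (\<lambda>_. \<mu>)) (PiM UNIV (\<lambda>_. \<mu>)) (\<lambda>\<omega>. \<lambda>x\<in>UNIV. \<omega> (x + d)) =
          distr (PiM UNIV (\<lambda>_. \<mu>)) env_space (env_shift d)"
        by (intro distr_cong) (simp_all add: sets_\<mu> env_shift_def[abs_def] restrict_def)
      ultimately show ?thesis by (simp add: R)
    qed
    have "AE w in Q. a \<le> \<xi> x w \<and> \<xi> x w \<le> b" for x
    proof -
      have "AE y in distr Q borel (\<xi> 0). a \<le> y \<and> y \<le> b"
        using bounds by (subst AE_distr_iff) auto
      then have "AE y in distr Q borel (\<xi> x). a \<le> y \<and> y \<le> b"
        by (simp only: ident[of x])
      then show ?thesis by (subst (asm) AE_distr_iff) auto
    qed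
    then have "AE w in Q. \<forall>x. a \<le> \<xi> x w \<and> \<xi> x w \<le> b"
      by (simp add: AE_all_countable)
    moreover have "{\<zeta> \<in> space env_space. \<forall>x. a \<le> \<zeta> x \<and> \<zeta> x \<le> b} \<in> sets env_space"
      by measurable
    ultimately show "AE \<zeta> in distr Q env_space (\<lambda>w x. \<xi> x w). \<forall>x. a \<le> \<zeta> x \<and> \<zeta> x \<le> b"
      by (subst AE_distr_iff) auto
  qed
qed

lemma annealed_deviation_le:
  fixes Q :: "'w measure" and \<xi> :: "int \<Rightarrow> 'w \<Rightarrow> real"
  assumes meas: "\<And>x. \<xi> x \<in> borel_measurable Q"
    and env: "stationary_environment (distr Q env_space (\<lambda>w x. \<xi> x w)) a b" and t: "0 \<le> t"
  shows "(\<integral>\<^sup>+p. ennreal \<bar>centred_max \<xi> t p\<bar> \<partial>annealed Q) \<le>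
    2 * stationary_environment.mean_gap (distr Q env_space (\<lambda>w x. \<xi> x w)) t"
proof -
  let ?R = "distr Q env_space (\<lambda>w x. \<xi> x w)"
  interpret stationary_environment ?R a b by (rule env)
  note [measurable] = measurable_environment[OF meas]
  have [measurable]: "(\<lambda>\<zeta>. \<integral>\<^sup>+c. ennreal \<bar>max_particle \<zeta> c t - quenched_mean_max \<zeta> t\<bar> \<partial>clock_space)
      \<in> borel_measurable env_space"
    by measurable
  have "(\<integral>\<^sup>+p. ennreal \<bar>centred_max \<xi> t p\<bar> \<partial>annealed Q) =
      (\<integral>\<^sup>+w. \<integral>\<^sup>+c. ennreal \<bar>centred_max \<xi> t (w, c)\<bar> \<partial>clock_space \<partial>Q)"
    using measurable_centred_max[OF meas, where t=t] unfolding annealed_def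
    by (subst clock_space.nn_integral_fst) auto
  also have "\<dots> = (\<integral>\<^sup>+\<zeta>. \<integral>\<^sup>+c. ennreal \<bar>max_particle \<zeta> c t - quenched_mean_max \<zeta> t\<bar> \<partial>clock_space \<partial>?R)"
    by (subst nn_integral_distr) (simp_all add: centred_max_def)
  also have "\<dots> \<le> (\<integral>\<^sup>+\<zeta>. 2 * gap \<zeta> t \<partial>?R)"
    by (intro nn_integral_mono_elliptic quenched_deviation_le_gap t)
  also have "\<dots> = 2 * mean_gap t"
    unfolding mean_gap_def by (rule nn_integral_cmult) measurable
  finally show ?thesis .
qed

theorem theorem1:
  fixes Q :: "'w measure" and \<xi> :: "int \<Rightarrow> 'w \<Rightarrow> real"
    and L :: nat and \<eta> \<delta> :: real
  assumes "prob_space Q"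
    and "prob_space.indep_vars Q (\<lambda>_. borel) \<xi> UNIV"
    and "\<And>x. distr Q borel (\<xi> x) = distr Q borel (\<xi> 0)"
    and "0 < essinf Q (\<lambda>w. ereal (\<xi> 0 w))"
    and "essinf Q (\<lambda>w. ereal (\<xi> 0 w)) < esssup Q (\<lambda>w. ereal (\<xi> 0 w))"
    and "esssup Q (\<lambda>w. ereal (\<xi> 0 w)) < \<infinity>"
    and "L \<ge> 1" and "0 \<le> \<eta>" and "\<eta> < 1 / real L" and "\<delta> > 0"
  shows "\<exists>t :: nat \<Rightarrow> real.
    strict_mono_on {1..} t \<and> (\<forall>k\<ge>1. t k \<in> shifted_lattice L \<eta>) \<and>
    limsup (\<lambda>k. ereal (t k / real k)) \<le> ereal ((1 + \<delta>) / real L) \<and>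
    tight (\<lambda>k. distr (annealed Q) borel (centred_max \<xi> (t (Suc k))))"
proof -
  interpret prob_space Q by fact
  have meas: "\<xi> x \<in> borel_measurable Q" for x
    using assms(2) by (simp add: indep_vars_def)
  obtain a b where ab: "0 < a" "AE w in Q. a \<le> \<xi> 0 w \<and> \<xi> 0 w \<le> b"
    using essinf_esssup_bounds[OF meas assms(4,6)] .
  let ?R = "distr Q env_space (\<lambda>w x. \<xi> x w)"
  have env: "stationary_environment ?R a b"
    by (rule iid_stationary_environment[OF assms(1-3) ab])
  then interpret R: stationary_environment ?R a b .
  have L: "0 < real L" using assms(7) by simp
  define h where "h = 1 / real L"
  have h: "0 < h" "\<eta> \<le> h" using L assms(9) by (simp_all add: h_def)
  define C where "C = R.growth_rate / a * exp (2 * (1 + b) * h)"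
  have C: "0 < C" using R.growth_rate_pos ab(1) by (simp add: C_def)
  have sums: "(\<Sum>k=1..n. R.mean_gap (real k * h + \<eta>)) \<le> ennreal (C * real (n + 2))" for n
    unfolding C_def by (rule R.lattice_sum_mean_gap_le[OF h(1) assms(8) h(2)])
  obtain g :: "nat \<Rightarrow> nat" where g: "strict_mono g" "\<And>k. 1 \<le> g k"
    "\<And>k. R.mean_gap (real (g k) * h + \<eta>) \<le> ennreal (C * (1 + \<delta>) / \<delta>)"
    "\<And>k. real (g k) \<le> (1 + \<delta>) * real (Suc k) + 2 * \<delta>"
    by (rule frequently_small_terms[OF C assms(10) sums]) (rule that)
  define t where "t k = real (g (k - 1)) * h + \<eta>" for k
  have "strict_mono_on {1..} t"
  proof (rule strict_mono_onI)
    fix k l :: nat assume "k \<in> {1..}" "l \<in> {1..}" "k < l"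
    then have "g (k - 1) < g (l - 1)" by (intro strict_monoD[OF g(1)]) auto
    then show "t k < t l" using h by (simp add: t_def)
  qed
  moreover have "t k \<in> shifted_lattice L \<eta>" for k
    using g(2) by (auto simp: shifted_lattice_def t_def h_def)
  moreover have "limsup (\<lambda>k. ereal (t k / real k)) \<le> ereal ((1 + \<delta>) / real L)"
  proof -
    let ?u = "\<lambda>k. (1 + \<delta>) * h + (2 * \<delta> * h + \<eta>) / real k"
    have "t k / real k \<le> ?u k" if "1 \<le> k" for k
    proof -
      have "real (g (k - 1)) \<le> (1 + \<delta>) * real k + 2 * \<delta>"
        using g(4)[of "k - 1"] that by simp
      then have "t k \<le> ((1 + \<delta>) * real k + 2 * \<delta>) * h + \<eta>"
        unfolding t_def using h by (intro add_right_mono mult_right_mono) auto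
      then have "t k / real k \<le> (((1 + \<delta>) * real k + 2 * \<delta>) * h + \<eta>) / real k"
        by (rule divide_right_mono) simp
      also have "\<dots> = ?u k" using that by (simp add: field_simps)
      finally show ?thesis .
    qed
    then have "limsup (\<lambda>k. ereal (t k / real k)) \<le> limsup (\<lambda>k. ereal (?u k))"
      by (intro Limsup_mono eventually_sequentiallyI[of 1]) simp
    also have "limsup (\<lambda>k. ereal (?u k)) = ereal ((1 + \<delta>) * h + 0)"
      by (intro lim_imp_Limsup tendsto_ereal tendsto_add tendsto_const) (simp_all add: lim_const_over_n)
    finally show ?thesis by (simp add: h_def)
  qed
  moreover have "tight (\<lambda>k. distr (annealed Q) borel (centred_max \<xi> (t (Suc k))))"
  proof (rule tight_if_bounded_mean)
    show "prob_space (annealed Q)"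
      unfolding annealed_def by (intro prob_space_pair assms(1) clock_space.prob_space_axioms)
    show "0 \<le> 2 * (C * (1 + \<delta>) / \<delta>)" using C assms(10) by simp
    fix k
    show "centred_max \<xi> (t (Suc k)) \<in> borel_measurable (annealed Q)"
      by (rule measurable_centred_max[OF meas])
    have "0 \<le> t (Suc k)" using h assms(8) by (simp add: t_def)
    then have "(\<integral>\<^sup>+p. ennreal \<bar>centred_max \<xi> (t (Suc k)) p\<bar> \<partial>annealed Q) \<le> 2 * R.mean_gap (t (Suc k))"
      by (rule annealed_deviation_le[OF meas env])
    also have "\<dots> \<le> 2 * ennreal (C * (1 + \<delta>) / \<delta>)"
      using g(3)[of k] by (intro mult_left_mono) (auto simp: t_def)
    also have "\<dots> = ennreal (2 * (C * (1 + \<delta>) / \<delta>))"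
      by (rule numeral_mult_ennreal) (use C assms(10) in simp)
    finally show "(\<integral>\<^sup>+p. ennreal \<bar>centred_max \<xi> (t (Suc k)) p\<bar> \<partial>annealed Q) \<le>
        ennreal (2 * (C * (1 + \<delta>) / \<delta>))" .
  qed
  ultimately show ?thesis by blast
qed

end
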